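(* Let $F:[0,T)\times M\to\mathbb{R}^{n+1}$ be a smooth solution of the normal hyperbolic mean curvature flow (HMCF'). For any integrable $U\subset M$ and any $0\le t_1\le t_2<T$ one has $$\left|\int_{t_1}^{t_2}\int_UH\,d\mu_t\,dt\right|=\frac1n\,|f_U(t_2)-f_U(t_1)|\le\frac{2\pi}{n\sqrt n}\,E_U$$ and $$\left|\int_{t_1}^{t_2}\int_UH\,e\,d\mu_t\,dt\right|=\left|f_U(t_2)-f_U(t_1)+\int_U\sigma\,d\mu_{t_1}-\int_U\sigma\,d\mu_{t_2}\right|\le\frac{2(\pi+1)}{\sqrt n}\,E_U.$$ In particular, if $T=\infty$, then for any $\epsilon>0$ and any choice of integrable $U\subset M$ there exists a sequence $t_k\to\infty$ such that $$\left|\int_UH\,d\mu_{t_k}\right|<\epsilon,\qquad k\in\mathbb{N},$$ and $$\left|\int_UH\,e\,d\mu_{t_k}\right|<\epsilon,\qquad k\in\mathbb{N}.$$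
   Context: $M$ is an orientable smooth $n$-dimensional manifold and $F$ is a smooth family of immersions. $\frac{d}{dt}$ is the time derivative at a fixed point of $M$; $F_i=\partial F/\partial x^i$; $g_{ij}=\langle F_i,F_j\rangle$ is the induced metric with Levi-Civita connection $\nabla$ and volume form $d\mu_t$; $\nu$ is the unit normal (inward pointing when $M$ is compact without boundary); $h_{ij}=-\langle F_i,\nabla_j\nu\rangle$, $H=g^{ij}h_{ij}$; $e=\frac12\left(\left|\frac{dF}{dt}\right|^2+n\right)$; $\nabla e=\nabla^ie\,F_i$. The equation (HMCF') is $$\frac{d^2}{dt^2}F=e\,H\nu-\nabla e,\qquad \left(\frac{dF}{dt}\right)^{\top}\Big|_{t=0}=0$$ ($\top$ = tangential part). Its solutions satisfy $\frac{dF}{dt}=\sigma\nu$, so $e=\frac12(\sigma^2+n)$, where $\sigma=\langle\frac{dF}{dt},\nu\rangle$. Define $$\gamma=\gamma(\sigma):=\frac{2}{\sqrt n}\arctan\left(\frac{\sigma}{\sqrt n}\right),\qquad f_U(t):=\int_U(\sigma+\gamma\,e)\,d\mu_t,\qquad E_U:=\int_Ue\,d\mu_t.$$ The quantity $E_U$ does not depend on $t$, since $\frac{d}{dt}(e\,d\mu_t)=0$ along the flow. "Integrable $U$" means a measurable subset for which the integrals over $U$ occurring here are well defined and finite.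
   Formalization: For T=∞ the two inequalities get separate sequences t_k (a common one can fail), and when U is not relatively compact the respective integral ∫_U H dμ_t or ∫_U H e dμ_t is assumed continuous in t (without this the claim can fail). *)

theory Defs
  imports "HOL-Analysis.Analysis"
begin

text \<open>
  Only used on open sets and on a half-open time interval times an open set. There the derivative
  within the set is unique and this is the usual notion (one-sided in time at the initial time).
\<close>

primrec ck_on :: "nat \<Rightarrow> 'a::euclidean_space set \<Rightarrow> ('a \<Rightarrow> 'b::real_normed_vector) \<Rightarrow> bool" where
  "ck_on 0 S f \<longleftrightarrow> continuous_on S f"
| "ck_on (Suc k) S f \<longleftrightarrow>
     (\<exists>f'. (\<forall>x\<in>S. (f has_derivative f' x) (at x within S)) \<and> (\<forall>v. ck_on k S (\<lambda>x. f' x v)))"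

definition smooth_on :: "'a::euclidean_space set \<Rightarrow> ('a \<Rightarrow> 'b::real_normed_vector) \<Rightarrow> bool" where
  "smooth_on S f \<longleftrightarrow> (\<forall>k. ck_on k S f)"

text \<open>
  Manifolds (without boundary) are Hausdorff, second countable types with a smooth atlas.
  A chart is a pair of its domain and its coordinate map; the values of the map
  outside the domain are irrelevant.
\<close>

type_synonym ('m, 'n) chart = "'m set \<times> ('m \<Rightarrow> real ^ 'n)"

definition chart_inv :: "('m, 'n::finite) chart \<Rightarrow> real ^ 'n \<Rightarrow> 'm" where
  "chart_inv c = inv_into (fst c) (snd c)"

definition is_chart :: "('m::topological_space, 'n::finite) chart \<Rightarrow> bool" where
  "is_chart c \<longleftrightarrow> open (fst c) \<and> open (snd c ` fst c) \<and>
     homeomorphism (fst c) (snd c ` fst c) (snd c) (chart_inv c)"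

definition smooth_atlas :: "('m::{t2_space, second_countable_topology}, 'n::finite) chart set \<Rightarrow> bool" where
  "smooth_atlas A \<longleftrightarrow> (\<forall>c\<in>A. is_chart c) \<and> (\<Union>c\<in>A. fst c) = UNIV \<and>
     (\<forall>c\<in>A. \<forall>d\<in>A. smooth_on (snd c ` (fst c \<inter> fst d)) (snd d \<circ> chart_inv c))"

definition orientable :: "('m::{t2_space, second_countable_topology}, 'n::finite) chart set \<Rightarrow> bool" where
  "orientable A \<longleftrightarrow> (\<exists>B. smooth_atlas B \<and> smooth_atlas (A \<union> B) \<and>
     (\<forall>c\<in>B. \<forall>d\<in>B. \<forall>y\<in>snd c ` (fst c \<inter> fst d).
        det (matrix (frechet_derivative (snd d \<circ> chart_inv c) (at y))) > 0))"

text \<open>The coordinate derivative \<open>\<partial>u/\<partial>x\<^sup>i\<close> at the point \<open>p\<close> of the chart \<open>c\<close>.\<close>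

definition pd :: "('m, 'n::finite) chart \<Rightarrow> ('m \<Rightarrow> 'b::real_normed_vector) \<Rightarrow> 'n \<Rightarrow> 'm \<Rightarrow> 'b" where
  "pd c u i p = frechet_derivative (u \<circ> chart_inv c) (at (snd c p)) (axis i 1)"

definition immersion :: "('m, 'n::finite) chart set \<Rightarrow> ('m \<Rightarrow> real ^ 'k::finite) \<Rightarrow> bool" where
  "immersion A f \<longleftrightarrow> (\<forall>c\<in>A. \<forall>p\<in>fst c. inj (frechet_derivative (f \<circ> chart_inv c) (at (snd c p))))"

definition metric :: "('m, 'n::finite) chart \<Rightarrow> ('m \<Rightarrow> real ^ 'k::finite) \<Rightarrow> 'm \<Rightarrow> real ^ 'n ^ 'n" where
  "metric c f p = (\<chi> i j. pd c f i p \<bullet> pd c f j p)"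

text \<open>
  The covariant derivative of \<open>\<nu>\<close> along a map into flat space is the coordinate derivative.
\<close>

definition second_ff ::
  "('m, 'n::finite) chart \<Rightarrow> ('m \<Rightarrow> real ^ 'k::finite) \<Rightarrow> ('m \<Rightarrow> real ^ 'k) \<Rightarrow> 'm \<Rightarrow> real ^ 'n ^ 'n" where
  "second_ff c f \<nu> p = (\<chi> i j. - (pd c f i p \<bullet> pd c \<nu> j p))"

text \<open>
  Mean curvature and gradient do not depend on the chart around \<open>p\<close>, so any one can be chosen.
\<close>

definition chart_at :: "('m, 'n::finite) chart set \<Rightarrow> 'm \<Rightarrow> ('m, 'n) chart" where
  "chart_at A p = (SOME c. c \<in> A \<and> p \<in> fst c)"

definition mean_curvature ::
  "('m, 'n::finite) chart set \<Rightarrow> ('m \<Rightarrow> real ^ 'k::finite) \<Rightarrow> ('m \<Rightarrow> real ^ 'k) \<Rightarrow> 'm \<Rightarrow> real" where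
  "mean_curvature A f \<nu> p = (let c = chart_at A p in
     \<Sum>i\<in>UNIV. \<Sum>j\<in>UNIV. matrix_inv (metric c f p) $ i $ j * second_ff c f \<nu> p $ i $ j)"

definition gradient ::
  "('m, 'n::finite) chart set \<Rightarrow> ('m \<Rightarrow> real ^ 'k::finite) \<Rightarrow> ('m \<Rightarrow> real) \<Rightarrow> 'm \<Rightarrow> real ^ 'k" where
  "gradient A f u p = (let c = chart_at A p in
     \<Sum>i\<in>UNIV. \<Sum>j\<in>UNIV. (matrix_inv (metric c f p) $ i $ j * pd c u j p) *\<^sub>R pd c f i p)"

text \<open>
  The measure of the volume form of the metric induced by \<open>f\<close>, on the Lebesgue
  measurable subsets of the manifold; in each chart it is \<open>sqrt (det g) dx\<close>. This determines it
  uniquely.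
\<close>

definition is_volume_measure ::
  "('m, 'n::finite) chart set \<Rightarrow> ('m \<Rightarrow> real ^ 'k::finite) \<Rightarrow> 'm measure \<Rightarrow> bool" where
  "is_volume_measure A f \<mu> \<longleftrightarrow>
     sets \<mu> = {B. \<forall>c\<in>A. snd c ` (B \<inter> fst c) \<in> sets lebesgue} \<and>
     (\<forall>c\<in>A. \<forall>B\<in>sets \<mu>. B \<subseteq> fst c \<longrightarrow>
        emeasure \<mu> B = (\<integral>\<^sup>+y\<in>snd c ` B. ennreal (sqrt (det (metric c f (chart_inv c y)))) \<partial>lebesgue))"

definition time_dom :: "ereal \<Rightarrow> real set" where
  "time_dom T = {t. 0 \<le> t \<and> ereal t < T}"

definition smooth_family ::
  "('m, 'n::finite) chart set \<Rightarrow> ereal \<Rightarrow> (real \<Rightarrow> 'm \<Rightarrow> 'b::real_normed_vector) \<Rightarrow> bool" where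
  "smooth_family A T X \<longleftrightarrow>
     (\<forall>c\<in>A. smooth_on (time_dom T \<times> snd c ` fst c) (\<lambda>(t, y). X t (chart_inv c y)))"

definition dt :: "ereal \<Rightarrow> (real \<Rightarrow> 'm \<Rightarrow> 'b::real_normed_vector) \<Rightarrow> real \<Rightarrow> 'm \<Rightarrow> 'b" where
  "dt T X t p = vector_derivative (\<lambda>s. X s p) (at t within time_dom T)"

definition is_unit_normal ::
  "('m, 'n::finite) chart set \<Rightarrow> ('m \<Rightarrow> real ^ 'k::finite) \<Rightarrow> ('m \<Rightarrow> real ^ 'k) \<Rightarrow> bool" where
  "is_unit_normal A f \<nu> \<longleftrightarrow>
     (\<forall>p. norm (\<nu> p) = 1) \<and> (\<forall>c\<in>A. \<forall>p\<in>fst c. \<forall>i. \<nu> p \<bullet> pd c f i p = 0)"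

definition energy_density ::
  "('m, 'n::finite) chart set \<Rightarrow> ereal \<Rightarrow> (real \<Rightarrow> 'm \<Rightarrow> real ^ 'k::finite) \<Rightarrow> real \<Rightarrow> 'm \<Rightarrow> real" where
  "energy_density A T F t p = ((norm (dt T F t p))\<^sup>2 + real CARD('n)) / 2"

definition normal_speed ::
  "ereal \<Rightarrow> (real \<Rightarrow> 'm \<Rightarrow> real ^ 'k::finite) \<Rightarrow> (real \<Rightarrow> 'm \<Rightarrow> real ^ 'k) \<Rightarrow> real \<Rightarrow> 'm \<Rightarrow> real" where
  "normal_speed T F \<nu> t p = dt T F t p \<bullet> \<nu> t p"

text \<open>
  The last condition says that the tangential part of the initial velocity vanishes. Either
  choice of the unit normal \<open>\<nu>\<close> is allowed; the product of mean curvature and \<open>\<nu>\<close>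
  does not depend on it.
\<close>

definition hmcf_solution ::
  "('m, 'n::finite) chart set \<Rightarrow> ereal \<Rightarrow> (real \<Rightarrow> 'm \<Rightarrow> real ^ 'k::finite) \<Rightarrow>
   (real \<Rightarrow> 'm \<Rightarrow> real ^ 'k) \<Rightarrow> bool" where
  "hmcf_solution A T F \<nu> \<longleftrightarrow>
     smooth_family A T F \<and> smooth_family A T \<nu> \<and>
     (\<forall>t\<in>time_dom T. immersion A (F t) \<and> is_unit_normal A (F t) (\<nu> t)) \<and>
     (\<forall>t\<in>time_dom T. \<forall>p. dt T (dt T F) t p =
        (energy_density A T F t p * mean_curvature A (F t) (\<nu> t) p) *\<^sub>R \<nu> t p
        - gradient A (F t) (energy_density A T F t) p) \<and>
     (\<forall>p. dt T F 0 p - (dt T F 0 p \<bullet> \<nu> 0 p) *\<^sub>R \<nu> 0 p = 0)"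

definition gamma_fun :: "nat \<Rightarrow> real \<Rightarrow> real" where
  "gamma_fun n s = 2 / sqrt (real n) * arctan (s / sqrt (real n))"

definition f_integrand ::
  "('m, 'n::finite) chart set \<Rightarrow> ereal \<Rightarrow> (real \<Rightarrow> 'm \<Rightarrow> real ^ 'k::finite) \<Rightarrow>
   (real \<Rightarrow> 'm \<Rightarrow> real ^ 'k) \<Rightarrow> real \<Rightarrow> 'm \<Rightarrow> real" where
  "f_integrand A T F \<nu> t p =
     normal_speed T F \<nu> t p + gamma_fun CARD('n) (normal_speed T F \<nu> t p) * energy_density A T F t p"

text \<open>
  All integrals over \<open>U\<close> at a fixed time, and the space-time integrals over compact time intervals,
  are required to converge absolutely. The Bochner integral of a function that is not integrable is 0.
\<close>

definition integrable_set ::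
  "('m, 'n::finite) chart set \<Rightarrow> ereal \<Rightarrow> (real \<Rightarrow> 'm \<Rightarrow> real ^ 'k::finite) \<Rightarrow>
   (real \<Rightarrow> 'm \<Rightarrow> real ^ 'k) \<Rightarrow> (real \<Rightarrow> 'm measure) \<Rightarrow> 'm set \<Rightarrow> bool" where
  "integrable_set A T F \<nu> \<mu> U \<longleftrightarrow>
     (\<forall>t\<in>time_dom T. U \<in> sets (\<mu> t) \<and>
        set_integrable (\<mu> t) U (energy_density A T F t) \<and>
        set_integrable (\<mu> t) U (normal_speed T F \<nu> t) \<and>
        set_integrable (\<mu> t) U (f_integrand A T F \<nu> t) \<and>
        set_integrable (\<mu> t) U (mean_curvature A (F t) (\<nu> t)) \<and>
        set_integrable (\<mu> t) U (\<lambda>p. mean_curvature A (F t) (\<nu> t) p * energy_density A T F t p)) \<and>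
     (\<forall>t1\<in>time_dom T. \<forall>t2\<in>time_dom T.
        (\<integral>\<^sup>+t\<in>{t1..t2}. (\<integral>\<^sup>+p\<in>U. ennreal \<bar>mean_curvature A (F t) (\<nu> t) p\<bar> \<partial>\<mu> t) \<partial>lborel) < \<infinity> \<and>
        (\<integral>\<^sup>+t\<in>{t1..t2}. (\<integral>\<^sup>+p\<in>U. ennreal \<bar>mean_curvature A (F t) (\<nu> t) p * energy_density A T F t p\<bar> \<partial>\<mu> t)
            \<partial>lborel) < \<infinity>)"

definition f_U ::
  "('m, 'n::finite) chart set \<Rightarrow> ereal \<Rightarrow> (real \<Rightarrow> 'm \<Rightarrow> real ^ 'k::finite) \<Rightarrow>
   (real \<Rightarrow> 'm \<Rightarrow> real ^ 'k) \<Rightarrow> (real \<Rightarrow> 'm measure) \<Rightarrow> 'm set \<Rightarrow> real \<Rightarrow> real" where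
  "f_U A T F \<nu> \<mu> U t = (LINT p:U|\<mu> t. f_integrand A T F \<nu> t p)"

definition E_U ::
  "('m, 'n::finite) chart set \<Rightarrow> ereal \<Rightarrow> (real \<Rightarrow> 'm \<Rightarrow> real ^ 'k::finite) \<Rightarrow>
   (real \<Rightarrow> 'm measure) \<Rightarrow> 'm set \<Rightarrow> real \<Rightarrow> real" where
  "E_U A T F \<mu> U t = (LINT p:U|\<mu> t. energy_density A T F t p)"

definition int_H ::
  "('m, 'n::finite) chart set \<Rightarrow> (real \<Rightarrow> 'm \<Rightarrow> real ^ 'k::finite) \<Rightarrow>
   (real \<Rightarrow> 'm \<Rightarrow> real ^ 'k) \<Rightarrow> (real \<Rightarrow> 'm measure) \<Rightarrow> 'm set \<Rightarrow> real \<Rightarrow> real" where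
  "int_H A F \<nu> \<mu> U t = (LINT p:U|\<mu> t. mean_curvature A (F t) (\<nu> t) p)"

definition int_He ::
  "('m, 'n::finite) chart set \<Rightarrow> ereal \<Rightarrow> (real \<Rightarrow> 'm \<Rightarrow> real ^ 'k::finite) \<Rightarrow>
   (real \<Rightarrow> 'm \<Rightarrow> real ^ 'k) \<Rightarrow> (real \<Rightarrow> 'm measure) \<Rightarrow> 'm set \<Rightarrow> real \<Rightarrow> real" where
  "int_He A T F \<nu> \<mu> U t =
     (LINT p:U|\<mu> t. mean_curvature A (F t) (\<nu> t) p * energy_density A T F t p)"

end

theory Submission imports Defs begin

text \<open>
  The tangential velocity \<open>\<langle>\<partial>\<^sub>t F, F\<^sub>i\<rangle>\<close> is constant in time, because the gradient term cancels
  \<open>\<partial>\<^sub>i e\<close>; hence \<open>\<partial>\<^sub>t F = \<sigma> \<nu>\<close>. It follows that \<open>\<partial>\<^sub>t \<sigma> = e H\<close>, \<open>\<partial>\<^sub>t e = \<sigma> e H\<close> and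
  \<open>\<partial>\<^sub>t det g = -2 \<sigma> H det g\<close>, so that \<open>e\<^sup>2 det g\<close>, and with it the finite measure \<open>m = e d\<mu>\<^sub>t\<close> on
  \<open>U\<close>, does not depend on time. With respect to \<open>m\<close> the densities of \<open>f\<^sub>U\<close> and of
  \<open>f\<^sub>U - \<integral>\<sigma> d\<mu>\<^sub>t\<close> are the bounded functions \<open>\<sigma>/e + \<gamma>\<close> and \<open>\<gamma>\<close>, whose time derivatives are
  \<open>n H / e\<close> and \<open>H\<close>. The identities are now Fubini's theorem, and the bounds are those of
  \<open>\<bar>\<sigma>/e + \<gamma>\<bar>\<close> and \<open>\<bar>\<gamma>\<bar>\<close> by \<open>\<pi>/\<surd>n\<close>. If a continuous function stays away from \<open>0\<close> for large times it
  has constant sign there, and its integrals are unbounded.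
\<close>

subsection \<open>Determinants, Gram matrices and mixed partial derivatives\<close>

text \<open>The choice of \<gamma> can be read off from \<partial>_t \<sigma> = e H. A function
  \<phi>(\<sigma>) changes at the rate \<phi>'(\<sigma>) e H, so the rate H belongs to a primitive
  of 1/e = 2/(\<sigma>^2 + n), and this is \<gamma>. For \<sigma>/e the rate is n H / e - H, because
  e - \<sigma>^2 = n - e; adding \<gamma> removes the term -H. Both \<gamma> and \<sigma>/e +
  \<gamma> take values in an interval of length 2 pi / sqrt n, which is the origin of the constants.
  The obstacles lie elsewhere. Derivatives at time 0 are one-sided, so every time derivative is
  taken within an interval starting at 0. Mean curvature and gradient refer to a chart selected
  separately at each point, so their regularity in space is hidden; the product e H, however, is the
  normal component of the acceleration, which is continuous in space and time. The volume measures
  of different times are linked only through their coordinate densities, so the conservation law is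
  first an identity of densities and then one of measures. Finally, absolute convergence of the
  space-time integrals gives no continuity in time of the space integrals, on which the sign
  argument rests.\<close>

lemma det_has_derivative_at_one:
  fixes X :: "real \<Rightarrow> real ^ 'n::finite ^ 'n"
  assumes X: "\<And>i j. ((\<lambda>s. X s $ i $ j) has_real_derivative D $ i $ j) (at t within S)"
    and one: "X t = mat 1"
  shows "((\<lambda>s. det (X s)) has_real_derivative (\<Sum>i\<in>UNIV. D $ i $ i)) (at t within S)"
proof -
  have d: "((\<lambda>s. det (X s)) has_derivative
     (\<lambda>h. \<Sum>p\<in>{p. p permutes UNIV}. of_int (sign p) *
        (\<Sum>i\<in>UNIV. (D $ i $ p i * h) * (\<Prod>j\<in>UNIV - {i}. X t $ j $ p j)))) (at t within S)"
    unfolding det_def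
    by (rule has_derivative_sum, rule has_derivative_mult_right, rule has_derivative_prod)
       (use X in \<open>simp add: has_field_derivative_def\<close>)
  \<comment> \<open>A permutation other than the identity moves at least two indices. After the
    factor \<open>i\<close> is deleted, an off-diagonal entry of the identity matrix remains, so
    only the term of the identity permutation survives; it is the trace.\<close>
  have z: "(\<Prod>j\<in>UNIV - {i}. X t $ j $ p j) = 0" if p: "p permutes UNIV" "p \<noteq> id" for p i
  proof -
    have "\<exists>j. j \<noteq> i \<and> p j \<noteq> j"
    proof (rule ccontr)
      assume a: "\<nexists>j. j \<noteq> i \<and> p j \<noteq> j"
      have "p i = i"
      proof (rule ccontr)
        assume "p i \<noteq> i"
        then have "p (p i) = p i" using a by blast
        then have "p i = i" using p(1) by (meson injD permutes_inj)
        then show False using \<open>p i \<noteq> i\<close> by simp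
      qed
      then have "p = id" using a by (auto simp: fun_eq_iff)
      then show False using p(2) by simp
    qed
    then show ?thesis
      by (intro prod_zero) (auto simp: one mat_def, metis DiffI UNIV_I singletonD)
  qed
  have "(\<Sum>p\<in>{p. p permutes UNIV}. of_int (sign p) *
        (\<Sum>i\<in>UNIV. (D $ i $ p i * h) * (\<Prod>j\<in>UNIV - {i}. X t $ j $ p j))) =
      (\<Sum>p\<in>{id}. of_int (sign p) *
        (\<Sum>i\<in>UNIV. (D $ i $ p i * h) * (\<Prod>j\<in>UNIV - {i}. X t $ j $ p j)))" for h
    by (rule sum.mono_neutral_right) (auto simp: z permutes_id)
  also have "\<dots> h = (\<Sum>i\<in>UNIV. D $ i $ i) * h" for h
    by (simp add: one mat_def sum_distrib_right)
  finally show ?thesis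
    using d by (simp add: has_field_derivative_def)
qed

lemma matrix_inv_inverse:
  fixes A :: "'a::semiring_1 ^ 'n ^ 'm"
  assumes "invertible A"
  shows "A ** matrix_inv A = mat 1 \<and> matrix_inv A ** A = mat 1"
  using assms unfolding invertible_def matrix_inv_def by (rule someI_ex)

lemma det_has_derivative:
  fixes X :: "real \<Rightarrow> real ^ 'n::finite ^ 'n"
  assumes X: "\<And>i j. ((\<lambda>s. X s $ i $ j) has_real_derivative D $ i $ j) (at t within S)"
    and inv: "invertible (X t)"
  shows "((\<lambda>s. det (X s)) has_real_derivative
     det (X t) * (\<Sum>i\<in>UNIV. \<Sum>j\<in>UNIV. matrix_inv (X t) $ i $ j * D $ j $ i)) (at t within S)"
proof -
  let ?Y = "matrix_inv (X t)"
  have i: "?Y ** X t = mat 1" "X t ** ?Y = mat 1"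
    using matrix_inv_inverse[OF inv] by auto
  \<comment> \<open>Multiplying by the inverse of \<open>X t\<close> reduces to the derivative at the identity.\<close>
  have "((\<lambda>s. det (?Y ** X s)) has_real_derivative (\<Sum>i\<in>UNIV. (?Y ** D) $ i $ i)) (at t within S)"
  proof (rule det_has_derivative_at_one)
    show "((\<lambda>s. (?Y ** X s) $ i $ j) has_real_derivative (?Y ** D) $ i $ j) (at t within S)" for i j
      unfolding matrix_matrix_mult_def vec_lambda_beta
      by (intro DERIV_sum DERIV_cmult X)
  qed (rule i(1))
  then have "((\<lambda>s. det (X t) * det (?Y ** X s)) has_real_derivative
      det (X t) * (\<Sum>i\<in>UNIV. (?Y ** D) $ i $ i)) (at t within S)"
    by (rule DERIV_cmult)
  moreover have "det (X t) * det (?Y ** X s) = det (X s)" for s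
    using arg_cong[OF i(2), of det] by (simp add: det_mul)
  ultimately show ?thesis by (simp add: matrix_matrix_mult_def)
qed

definition gram :: "('n::finite \<Rightarrow> 'b::real_inner) \<Rightarrow> real ^ 'n ^ 'n" where
  "gram q = (\<chi> i j. q i \<bullet> q j)"

text \<open>Transposing \<open>G ** matrix_inv G = mat 1\<close> exhibits the transposed inverse as
  a left inverse of \<open>G\<close>. The symmetry justifies the index swaps in the gradient and in
  the trace that defines the mean curvature.\<close>

lemma matrix_inv_symmetric:
  fixes G :: "real ^ 'n::finite ^ 'n"
  assumes "invertible G" "transpose G = G"
  shows "matrix_inv G $ i $ j = matrix_inv G $ j $ i"
proof -
  have i: "matrix_inv G ** G = mat 1" "G ** matrix_inv G = mat 1"
    using matrix_inv_inverse[OF assms(1)] by auto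
  have "transpose (matrix_inv G) ** G = mat 1"
    using arg_cong[OF i(2), of transpose] by (simp add: matrix_transpose_mul assms(2) transpose_mat)
  then have eq: "transpose (matrix_inv G) = matrix_inv G"
    using i(2) matrix_mul_assoc[of "transpose (matrix_inv G)" G "matrix_inv G"] by simp
  have "matrix_inv G $ i $ j = transpose (matrix_inv G) $ j $ i" by (simp add: transpose_def)
  then show ?thesis by (simp only: eq)
qed

text \<open>The quadratic form of the Gram matrix at \<open>x\<close> is the squared norm of the
  combination with coefficients \<open>x\<close>, so independence of the vectors leaves only the
  trivial kernel.\<close>

lemma invertible_gram:
  fixes q :: "'n::finite \<Rightarrow> 'b::real_inner"
  assumes "\<And>x :: real ^ 'n. (\<Sum>i\<in>UNIV. x $ i *\<^sub>R q i) = 0 \<Longrightarrow> x = 0"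
  shows "invertible (gram q)"
proof -
  have "x = 0" if "gram q *v x = 0" for x
  proof -
    have "(\<Sum>i\<in>UNIV. x $ i *\<^sub>R q i) \<bullet> (\<Sum>i\<in>UNIV. x $ i *\<^sub>R q i) = x \<bullet> (gram q *v x)"
      by (simp add: inner_vec_def gram_def matrix_vector_mult_def inner_sum_left inner_sum_right
          sum_distrib_left sum_distrib_right inner_commute mult_ac)
    then show ?thesis using that assms by simp
  qed
  then show ?thesis
    by (simp add: invertible_left_inverse matrix_left_invertible_ker)
qed

text \<open>This is where codimension one enters: the vectors \<open>q i\<close> span a space of
  dimension n, and \<open>N\<close> lies outside it, so together they span everything. The vector w
  - (w . N) N is orthogonal to this spanning set, hence to itself.\<close>

lemma orthogonal_hyperplane_normal:
  fixes q :: "'n::finite \<Rightarrow> real ^ 'k::finite"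
  assumes ind: "\<And>x :: real ^ 'n. (\<Sum>i\<in>UNIV. x $ i *\<^sub>R q i) = 0 \<Longrightarrow> x = 0"
    and card: "CARD('k) = CARD('n) + 1"
    and N: "norm N = 1" "\<And>i. N \<bullet> q i = 0"
    and w: "\<And>i. w \<bullet> q i = 0"
  shows "w = (w \<bullet> N) *\<^sub>R N"
proof -
  define L where "L = (\<lambda>x :: real ^ 'n. \<Sum>i\<in>UNIV. x $ i *\<^sub>R q i)"
  have lin: "linear L" unfolding L_def
    by (rule linearI) (simp_all add: scaleR_left_distrib sum.distrib scaleR_sum_right)
  have injL: "inj L" using ind by (simp add: linear_injective_0[OF lin]) (simp add: L_def)
  have sub: "subspace (range L)" using lin by (simp add: linear_subspace_image)
  have dimL: "dim (range L) = CARD('n)"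
    using dim_image_eq[OF lin, of UNIV] injL by (simp add: inj_on_def inj_def)
  have NL: "N \<bullet> v = 0" if "v \<in> range L" for v
    using that N(2) by (auto simp: L_def inner_sum_right)
  have "N \<notin> range L" using NL[of N] N(1) by auto
  then have "N \<notin> span (range L)" using sub by (simp add: span_eq_iff[THEN iffD2])
  then have "dim (insert N (range L)) = DIM(real ^ 'k)"
    using dimL card by (simp add: dim_insert)
  then have sp: "span (insert N (range L)) = UNIV" unfolding dim_eq_full .
  define u where "u = w - (w \<bullet> N) *\<^sub>R N"
  have "orthogonal u v" if "v \<in> insert N (range L)" for v
    using that N w
    by (auto simp: u_def orthogonal_def inner_diff_left L_def inner_sum_right power2_norm_eq_inner[symmetric])
  then have "orthogonal u u"
    using orthogonal_to_span[of u "insert N (range L)" u] sp by blast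
  then have "u = 0" by (simp add: orthogonal_def)
  then show ?thesis by (simp add: u_def)
qed

lemma has_vector_derivative_along_line:
  assumes G: "(G has_derivative DG) (at (c + r *\<^sub>R w) within S)"
    and J: "\<And>r. r \<in> J \<Longrightarrow> c + r *\<^sub>R w \<in> S"
  shows "((\<lambda>r. G (c + r *\<^sub>R w)) has_vector_derivative DG w) (at r within J)"
proof -
  have "((\<lambda>r. c + r *\<^sub>R w) has_derivative (\<lambda>h. h *\<^sub>R w)) (at r within J)"
    by (auto intro!: derivative_eq_intros)
  moreover have "(G has_derivative DG) (at (c + r *\<^sub>R w) within (\<lambda>r. c + r *\<^sub>R w) ` J)"
    by (rule has_derivative_subset[OF G]) (use J in auto)
  ultimately have "((\<lambda>r. G (c + r *\<^sub>R w)) has_derivative (\<lambda>h. DG (h *\<^sub>R w))) (at r within J)"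
    by (rule has_derivative_in_compose)
  then show ?thesis
    by (simp add: has_vector_derivative_def linear_scale[OF has_derivative_linear[OF G]])
qed

text \<open>
  Differentiating the time integral of \<open>DG (1, 0)\<close> under the integral sign, instead of using the
  symmetry of second derivatives, covers the one-sided derivative at the initial time.
\<close>

lemma mixed_partial_derivative:
  fixes G :: "real \<times> 'a::euclidean_space \<Rightarrow> 'b::euclidean_space"
  assumes G: "\<And>z. z \<in> I \<times> V \<Longrightarrow> (G has_derivative DG z) (at z within I \<times> V)"
    and P: "\<And>z. z \<in> I \<times> V \<Longrightarrow> ((\<lambda>z. DG z (1, 0)) has_derivative DP z) (at z within I \<times> V)"
    and cP: "continuous_on (I \<times> V) (\<lambda>z. DP z (0, v))"
    and V: "open V" "x \<in> V"
    and ab: "a \<le> b" "{a..b} \<subseteq> I"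
    and t: "t \<in> {a..b}"
  shows "((\<lambda>s. DG (s, x) (0, v)) has_vector_derivative DP (t, x) (0, v)) (at t within {a..b})"
proof -
  have "open ((\<lambda>r. x + r *\<^sub>R v) -` V)"
    by (intro open_vimage V continuous_intros)
  moreover have "0 \<in> (\<lambda>r. x + r *\<^sub>R v) -` V" using V(2) by simp
  ultimately obtain d where d: "d > 0" "cball (0::real) d \<subseteq> (\<lambda>r. x + r *\<^sub>R v) -` V"
    unfolding open_contains_cball by metis
  define J where "J = {-d..d}"
  have J: "x + r *\<^sub>R v \<in> V" if "r \<in> J" for r
    using d(2) that by (auto simp: J_def dist_norm subset_iff)
  have timeder: "((\<lambda>s. G (s, y)) has_vector_derivative DG (s, y) (1, 0)) (at s within {a..b})"
    if "s \<in> {a..b}" "y \<in> V" for s y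
    using has_vector_derivative_along_line[of G "DG (s, y)" "(0, y)" s "(1, 0)" "I \<times> V" "{a..b}"] G[of "(s, y)"] that ab
    by (auto simp: subset_iff)
  have spaceder: "((\<lambda>r. g (s, x + r *\<^sub>R v)) has_vector_derivative Dg (s, x + r *\<^sub>R v) (0, v)) (at r within J)"
    if s: "s \<in> {a..b}" and r: "r \<in> J"
      and g: "\<And>z. z \<in> I \<times> V \<Longrightarrow> (g has_derivative Dg z) (at z within I \<times> V)"
    for s r and g :: "real \<times> 'a \<Rightarrow> 'b" and Dg
    using has_vector_derivative_along_line[of g "Dg (s, x + r *\<^sub>R v)" "(s, x)" r "(0, v)" "I \<times> V" J] g[of "(s, x + r *\<^sub>R v)"] s r ab J
    by (auto simp: subset_iff)
  have contP: "continuous_on (I \<times> V) (\<lambda>z. DG z (1, 0))"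
    using P has_derivative_continuous continuous_on_eq_continuous_within by blast
  \<comment> \<open>The increment of \<open>G\<close> over [a, u] is the time integral of
    \<open>DG z (1, 0)\<close>. Both sides are differentiated in \<open>r\<close> at 0 along
    \<open>x + r *\<^sub>R v\<close>, the integral by the Leibniz rule; comparing the results gives
    the increment of the spatial derivative.\<close>
  have main: "DG (u, x) (0, v) = DG (a, x) (0, v) + integral {a..u} (\<lambda>s. DP (s, x) (0, v))"
    if u: "u \<in> {a..b}" for u
  proof -
    have au: "{a..u} \<subseteq> {a..b}" "a \<le> u" using u by auto
    have int: "((\<lambda>s. DG (s, y) (1, 0)) has_integral G (u, y) - G (a, y)) {a..u}" if "y \<in> V" for y
      by (rule fundamental_theorem_of_calculus)
         (use au that in \<open>auto intro!: has_vector_derivative_within_subset[OF timeder]\<close>)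
    have lei: "((\<lambda>r. integral (cbox a u) (\<lambda>s. DG (s, x + r *\<^sub>R v) (1, 0))) has_vector_derivative
        integral (cbox a u) (\<lambda>s. DP (s, x + 0 *\<^sub>R v) (0, v))) (at 0 within J)"
    proof (rule leibniz_rule_vector_derivative[where fx="\<lambda>r s. DP (s, x + r *\<^sub>R v) (0, v)"])
      show "((\<lambda>r. DG (s, x + r *\<^sub>R v) (1, 0)) has_vector_derivative DP (s, x + r *\<^sub>R v) (0, v)) (at r within J)"
        if "r \<in> J" "s \<in> cbox a u" for r s
        using spaceder[OF _ _ P, of s r] that au by auto
      show "(\<lambda>s. DG (s, x + r *\<^sub>R v) (1, 0)) integrable_on cbox a u" if "r \<in> J" for r
        using int[OF J[OF that]] by (auto simp: integrable_on_def)
      have "continuous_on (J \<times> cbox a u) ((\<lambda>z. DP z (0, v)) \<circ> (\<lambda>(r, s). (s, x + r *\<^sub>R v)))"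
        by (rule continuous_on_compose)
           (use au ab J in \<open>auto intro!: continuous_intros continuous_on_subset[OF cP] simp: case_prod_unfold\<close>)
      then show "continuous_on (J \<times> cbox a u) (\<lambda>(r, s). DP (s, x + r *\<^sub>R v) (0, v))"
        by (simp add: o_def case_prod_unfold)
      show "0 \<in> J" "convex J" using d by (auto simp: J_def)
    qed
    have "((\<lambda>r. G (u, x + r *\<^sub>R v) - G (a, x + r *\<^sub>R v)) has_vector_derivative
        DG (u, x + 0 *\<^sub>R v) (0, v) - DG (a, x + 0 *\<^sub>R v) (0, v)) (at 0 within J)"
      by (rule has_vector_derivative_diff; rule spaceder[OF _ _ G]) (use u ab d in \<open>auto simp: J_def\<close>)
    then have "((\<lambda>r. integral (cbox a u) (\<lambda>s. DG (s, x + r *\<^sub>R v) (1, 0))) has_vector_derivative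
        DG (u, x + 0 *\<^sub>R v) (0, v) - DG (a, x + 0 *\<^sub>R v) (0, v)) (at 0 within J)"
      by (rule has_vector_derivative_transform[rotated 2]) (use d int[OF J] in \<open>auto simp: J_def integral_unique\<close>)
    moreover have "at 0 within J \<noteq> bot"
      using d by (simp add: J_def trivial_limit_within islimpt_Icc)
    ultimately show ?thesis
      using vector_derivative_unique_within[OF _ _ lei] by (auto simp: algebra_simps)
  qed
  have "continuous_on {a..b} ((\<lambda>z. DP z (0, v)) \<circ> (\<lambda>s. (s, x)))"
    by (rule continuous_on_compose)
       (use ab V in \<open>auto intro!: continuous_intros continuous_on_subset[OF cP]\<close>)
  then have "((\<lambda>u. integral {a..u} (\<lambda>s. DP (s, x) (0, v))) has_vector_derivative DP (t, x) (0, v)) (at t within {a..b})"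
    unfolding o_def using integral_has_vector_derivative t by blast
  then have "((\<lambda>u. integral {a..u} (\<lambda>s. DP (s, x) (0, v)) + DG (a, x) (0, v)) has_vector_derivative
      DP (t, x) (0, v)) (at t within {a..b})"
    by (simp only: has_vector_derivative_add_const)
  then show ?thesis
  proof (rule has_vector_derivative_transform[OF t, rotated])
    show "DG (s, x) (0, v) = integral {a..s} (\<lambda>s. DP (s, x) (0, v)) + DG (a, x) (0, v)" if "s \<in> {a..b}" for s
      using main[OF that] by (simp only: add.commute)
  qed
qed

subsection \<open>Exchanging time and space integrals\<close>

text \<open>Rounding the time down to a grid of mesh 1 / (k + 1) leaves countably many times, so the
  rounded function is jointly measurable. By continuity in time it converges pointwise to
  \<open>h\<close> as k grows.\<close>

lemma borel_measurable_caratheodory_Icc: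
  fixes h :: "real \<Rightarrow> 'a \<Rightarrow> real"
  assumes meas: "\<And>t. t \<in> {a..b} \<Longrightarrow> h t \<in> borel_measurable M"
    and cont: "\<And>p. p \<in> space M \<Longrightarrow> continuous_on {a..b} (\<lambda>t. h t p)"
    and ab: "a \<le> b"
  shows "(\<lambda>(t, p). indicator {a..b} t * h t p) \<in> borel_measurable (lborel \<Otimes>\<^sub>M M)"
proof -
  \<comment> \<open>Rounding down may leave the interval on the left. Clamping to [a, b] keeps every
    grid time where \<open>h\<close> is known to be measurable and changes nothing inside the
    interval.\<close>
  define c where "c = (\<lambda>t. max a (min b t))"
  have c: "c t \<in> {a..b}" for t using ab by (auto simp: c_def)
  define r where "r = (\<lambda>(k::nat) t. real_of_int \<lfloor>real (Suc k) * t\<rfloor> / real (Suc k))"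
  have r: "(\<lambda>k. r k t) \<longlonglongrightarrow> t" for t
  proof (rule tendsto_sandwich[of "\<lambda>k. t - inverse (real (Suc k))" _ _ "\<lambda>k. t"])
    have "t \<le> inverse (real (Suc k)) + r k t" for k
    proof -
      have "real (Suc k) * t \<le> 1 + of_int \<lfloor>real (Suc k) * t\<rfloor>" by linarith
      then show ?thesis by (simp add: r_def field_simps del: of_nat_Suc)
    qed
    then show "\<forall>\<^sub>F k in sequentially. t - inverse (real (Suc k)) \<le> r k t"
      by (simp add: algebra_simps)
    have "r k t \<le> t" for k
    proof -
      have "of_int \<lfloor>real (Suc k) * t\<rfloor> \<le> real (Suc k) * t" by linarith
      then show ?thesis by (simp add: r_def field_simps del: of_nat_Suc)
    qed
    then show "\<forall>\<^sub>F k in sequentially. r k t \<le> t" by simp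
    have "(\<lambda>k. t - inverse (real (Suc k))) \<longlonglongrightarrow> t - 0"
      by (intro tendsto_intros LIMSEQ_inverse_real_of_nat)
    then show "(\<lambda>k. t - inverse (real (Suc k))) \<longlonglongrightarrow> t" by simp
  qed auto
  have "(\<lambda>z :: real \<times> 'a. h (c (fst z)) (snd z)) \<in> borel_measurable (lborel \<Otimes>\<^sub>M M)"
  proof (rule borel_measurable_LIMSEQ_metric)
    fix k
    have "(\<lambda>z. h (c (real_of_int \<lfloor>real (Suc k) * fst z\<rfloor> / real (Suc k))) (snd z))
        \<in> borel_measurable (lborel \<Otimes>\<^sub>M M)"
    proof (rule measurable_compose_countable[where f="\<lambda>i z. h (c (real_of_int i / real (Suc k))) (snd z)"
          and g="\<lambda>z. \<lfloor>real (Suc k) * fst z\<rfloor>"])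
      show "(\<lambda>z. h (c (real_of_int i / real (Suc k))) (snd z)) \<in> borel_measurable (lborel \<Otimes>\<^sub>M M)" for i
        by (rule measurable_compose[OF measurable_snd meas[OF c]])
      show "(\<lambda>z. \<lfloor>real (Suc k) * fst z\<rfloor>) \<in> lborel \<Otimes>\<^sub>M M \<rightarrow>\<^sub>M count_space UNIV"
        by measurable
    qed
    then show "(\<lambda>z. h (c (r k (fst z))) (snd z)) \<in> borel_measurable (lborel \<Otimes>\<^sub>M M)"
      by (simp add: r_def)
  next
    fix z :: "real \<times> 'a" assume "z \<in> space (lborel \<Otimes>\<^sub>M M)"
    then have p: "snd z \<in> space M" by (auto simp: space_pair_measure)
    have "(\<lambda>k. c (r k (fst z))) \<longlonglongrightarrow> c (fst z)"
      unfolding c_def by (intro tendsto_intros r)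
    then show "(\<lambda>k. h (c (r k (fst z))) (snd z)) \<longlonglongrightarrow> h (c (fst z)) (snd z)"
      by (rule continuous_on_tendsto_compose[OF cont[OF p]]) (use c in auto)
  qed
  then have "(\<lambda>z. indicator {a..b} (fst z) * h (c (fst z)) (snd z)) \<in> borel_measurable (lborel \<Otimes>\<^sub>M M)"
    by measurable
  also have "(\<lambda>z. indicator {a..b} (fst z) * h (c (fst z)) (snd z)) = (\<lambda>(t, p). indicator {a..b} t * h t p)"
    by (auto simp: fun_eq_iff c_def indicator_def)
  finally show ?thesis .
qed

text \<open>Joint measurability and \<open>fin\<close> make the integrand absolutely integrable on
  the product, so Fubini applies; the inner time integral is then an increment of \<Phi> for each
  fixed point.\<close>

lemma integral_FTC_swap:
  fixes h \<Phi> :: "real \<Rightarrow> 'a \<Rightarrow> real"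
  assumes M: "finite_measure M"
    and ab: "a \<le> b"
    and meas: "\<And>t. t \<in> {a..b} \<Longrightarrow> h t \<in> borel_measurable M"
    and cont: "\<And>p. p \<in> space M \<Longrightarrow> continuous_on {a..b} (\<lambda>t. h t p)"
    and deriv: "\<And>p t. p \<in> space M \<Longrightarrow> t \<in> {a..b} \<Longrightarrow>
       ((\<lambda>t. \<Phi> t p) has_real_derivative h t p) (at t within {a..b})"
    and int: "integrable M (\<Phi> a)" "integrable M (\<Phi> b)"
    and fin: "(\<integral>\<^sup>+t\<in>{a..b}. (\<integral>\<^sup>+p. ennreal \<bar>h t p\<bar> \<partial>M) \<partial>lborel) < \<infinity>"
  shows "(LBINT t:{a..b}. (LINT p|M. h t p)) = (LINT p|M. \<Phi> b p) - (LINT p|M. \<Phi> a p)"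
proof -
  interpret M: finite_measure M by fact
  interpret pair_sigma_finite lborel M ..
  let ?g = "\<lambda>t p. indicator {a..b} t * h t p"
  have m: "(\<lambda>(t, p). ?g t p) \<in> borel_measurable (lborel \<Otimes>\<^sub>M M)"
    by (rule borel_measurable_caratheodory_Icc[OF meas cont ab])
  have i: "integrable (lborel \<Otimes>\<^sub>M M) (\<lambda>(t, p). ?g t p)"
  proof (rule integrableI_bounded)
    have "(\<integral>\<^sup>+z. ennreal (norm (case z of (t, p) \<Rightarrow> ?g t p)) \<partial>(lborel \<Otimes>\<^sub>M M)) =
       (\<integral>\<^sup>+t. (\<integral>\<^sup>+p. ennreal (norm (?g t p)) \<partial>M) \<partial>lborel)"
      using m by (subst M.nn_integral_fst[symmetric]) (auto simp: case_prod_unfold)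
    also have "\<dots> = (\<integral>\<^sup>+t\<in>{a..b}. (\<integral>\<^sup>+p. ennreal \<bar>h t p\<bar> \<partial>M) \<partial>lborel)"
      by (intro nn_integral_cong) (auto simp: indicator_def)
    finally show "(\<integral>\<^sup>+z. ennreal (norm (case z of (t, p) \<Rightarrow> ?g t p)) \<partial>(lborel \<Otimes>\<^sub>M M)) < \<infinity>"
      using fin by simp
  qed (rule m)
  have "(LBINT t:{a..b}. (LINT p|M. h t p)) = (LBINT t. (LINT p|M. ?g t p))"
    unfolding set_lebesgue_integral_def by (intro Bochner_Integration.integral_cong) auto
  also have "\<dots> = (LINT p|M. (LBINT t. ?g t p))"
    using Fubini_integral[OF i] by simp
  also have "\<dots> = (LINT p|M. \<Phi> b p - \<Phi> a p)"
  proof (intro Bochner_Integration.integral_cong refl)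
    fix p assume p: "p \<in> space M"
    have "(LBINT t. indicator {a..b} t *\<^sub>R h t p) = \<Phi> b p - \<Phi> a p"
      by (rule integral_FTC_Icc[OF ab])
         (use deriv cont p in \<open>auto simp: has_real_derivative_iff_has_vector_derivative\<close>)
    then show "(LBINT t. ?g t p) = \<Phi> b p - \<Phi> a p" by simp
  qed
  finally show ?thesis using int by simp
qed

lemma small_values_of_bounded_primitive:
  fixes h :: "real \<Rightarrow> real"
  assumes cont: "continuous_on {0..} h"
    and bound: "\<And>a b. 0 \<le> a \<Longrightarrow> a \<le> b \<Longrightarrow> \<bar>LBINT t:{a..b}. h t\<bar> \<le> C"
    and \<epsilon>: "\<epsilon> > 0"
  shows "\<exists>\<tau>::nat \<Rightarrow> real. (\<forall>k. 0 \<le> \<tau> k) \<and> filterlim \<tau> at_top sequentially \<and> (\<forall>k. \<bar>h (\<tau> k)\<bar> < \<epsilon>)"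
proof -
  have ex: "\<exists>t\<ge>real k. \<bar>h t\<bar> < \<epsilon>" for k
  proof (rule ccontr)
    assume "\<not> ?thesis"
    then have big: "\<bar>h t\<bar> \<ge> \<epsilon>" if "t \<ge> real k" for t using that by force
    have C: "C \<ge> 0" using bound[of 0 0] by linarith
    \<comment> \<open>The length is chosen so that \<epsilon> L = C + \<epsilon> exceeds the bound
      \<open>C\<close>.\<close>
    define L where "L = C / \<epsilon> + 1"
    have L: "L > 0" "\<epsilon> * L > C" using C \<epsilon> by (auto simp: L_def field_simps add_nonneg_pos)
    define J where "J = {real k..real k + L}"
    have J: "J \<subseteq> {0..}" by (auto simp: J_def)
    have cJ: "continuous_on J h" using cont J continuous_on_subset by blast
    have int: "set_integrable lborel J h"
      using borel_integrable_compact[of J h] cJ by (simp add: J_def set_integrable_def)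
    have intc: "set_integrable lborel J (\<lambda>t. c)" for c :: real
      using borel_integrable_compact[of J "\<lambda>t. c"] by (simp add: J_def set_integrable_def)
    have cst: "(LBINT t:J. c) = c * L" for c :: real
      using L by (simp add: J_def set_lebesgue_integral_def)
    \<comment> \<open>The image is connected and misses the interval (-\<epsilon>, \<epsilon>), so
      it lies on one side of 0 and nothing cancels in the integral.\<close>
    have "connected (h ` J)" using cJ by (intro connected_continuous_image) (auto simp: J_def)
    then have "(\<forall>t\<in>J. h t \<ge> \<epsilon>) \<or> (\<forall>t\<in>J. h t \<le> -\<epsilon>)"
    proof -
      have "False" if "s \<in> J" "t \<in> J" "h s < \<epsilon>" "h t > -\<epsilon>" for s t
      proof -
        have "h s \<le> -\<epsilon>" "h t \<ge> \<epsilon>" using big[of s] big[of t] that by (auto simp: J_def)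
        then have "0 \<in> h ` J"
          using connectedD_interval[OF \<open>connected (h ` J)\<close>, of "h s" "h t" 0] that \<epsilon> by auto
        then show False using big \<epsilon> by (force simp: J_def)
      qed
      then show ?thesis by (meson not_less)
    qed
    then have "\<bar>LBINT t:J. h t\<bar> \<ge> \<epsilon> * L"
    proof
      assume "\<forall>t\<in>J. h t \<ge> \<epsilon>"
      then have "(LBINT t:J. \<epsilon>) \<le> (LBINT t:J. h t)" by (intro set_integral_mono int intc) auto
      then show ?thesis using cst by simp
    next
      assume "\<forall>t\<in>J. h t \<le> -\<epsilon>"
      then have "(LBINT t:J. h t) \<le> (LBINT t:J. -\<epsilon>)" by (intro set_integral_mono int intc) auto
      then show ?thesis using cst[of "-\<epsilon>"] by simp
    qed
    then show False using bound[of "real k" "real k + L"] L by (auto simp: J_def)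
  qed
  then obtain \<tau> where \<tau>: "\<And>k. \<tau> k \<ge> real k" "\<And>k. \<bar>h (\<tau> k)\<bar> < \<epsilon>" 
    using ex by metis
  have "filterlim \<tau> at_top sequentially"
    by (rule filterlim_at_top_mono[OF filterlim_real_sequentially]) (simp add: \<tau>(1))
  moreover have "0 \<le> \<tau> k" for k using \<tau>(1)[of k] by linarith
  ultimately show ?thesis using \<tau>(2) by (intro exI[of _ \<tau>]) simp
qed

subsection \<open>Charts\<close>

lemma time_dom_Icc: "b \<in> time_dom T \<Longrightarrow> {0..b} \<subseteq> time_dom T"
  unfolding time_dom_def by (auto intro: le_less_trans[of "ereal _" "ereal b"])

lemma time_dom_greater:
  assumes "t \<in> time_dom T"
  obtains b where "b > t" "b \<in> time_dom T"
proof -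
  obtain b where "ereal t < ereal b" "ereal b < T"
    using assms ereal_dense3[of "ereal t" T] ereal_dense2[of "ereal t" T] unfolding time_dom_def by auto
  then show thesis using assms that by (auto simp: time_dom_def)
qed

text \<open>A later time always exists, since \<open>T\<close> itself is excluded. Nontriviality of
  the filter makes the derivative within the time domain unique, also at time 0; without it
  \<open>dt\<close> could not be identified with a computed derivative.\<close>

lemma at_within_time_dom_nonbot:
  assumes "t \<in> time_dom T"
  shows "at t within time_dom T \<noteq> bot"
proof -
  obtain b where b: "b > t" "b \<in> time_dom T" using time_dom_greater[OF assms] .
  have "t islimpt {0..b}" using b assms by (simp add: islimpt_Icc time_dom_def)
  then have "t islimpt time_dom T" using time_dom_Icc[OF b(2)] islimpt_subset by blast
  then show ?thesis by (simp add: trivial_limit_within)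
qed

lemma is_chartD:
  assumes "is_chart c"
  shows "open (fst c)" "open (snd c ` fst c)" "continuous_on (fst c) (snd c)"
    "continuous_on (snd c ` fst c) (chart_inv c)"
    "\<And>p. p \<in> fst c \<Longrightarrow> chart_inv c (snd c p) = p"
    "\<And>y. y \<in> snd c ` fst c \<Longrightarrow> snd c (chart_inv c y) = y"
    "\<And>y. y \<in> snd c ` fst c \<Longrightarrow> chart_inv c y \<in> fst c"
  using assms unfolding is_chart_def homeomorphism_def by blast+

text \<open>The domain is closed on one side in time, so derivatives are taken within it and carried
  along as explicit functions. For each fixed first direction \<open>w\<close> the map
  \<open>DDF w\<close> is the derivative of \<open>z \<mapsto> Df z w\<close>; this is the form in
  which \<open>ck_on\<close> supplies it, and no symmetry in the two directions is asserted.\<close>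

definition is_jet2 ::
  "'a::euclidean_space set \<Rightarrow> ('a \<Rightarrow> 'b::real_normed_vector) \<Rightarrow> ('a \<Rightarrow> 'a \<Rightarrow> 'b) \<Rightarrow> ('a \<Rightarrow> 'a \<Rightarrow> 'a \<Rightarrow> 'b) \<Rightarrow> bool" where
  "is_jet2 S f Df DDf \<longleftrightarrow>
     (\<forall>z\<in>S. (f has_derivative Df z) (at z within S)) \<and>
     (\<forall>w. \<forall>z\<in>S. ((\<lambda>z. Df z w) has_derivative DDf w z) (at z within S)) \<and>
     (\<forall>w v. continuous_on S (\<lambda>z. DDf w z v))"

lemma smooth_on_jet2:
  assumes "smooth_on S f"
  obtains Df DDf where "is_jet2 S f Df DDf"
proof -
  have "ck_on (Suc (Suc 0)) S f" using assms by (simp add: smooth_on_def)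
  then obtain Df where Df: "\<forall>z\<in>S. (f has_derivative Df z) (at z within S)" "\<forall>w. ck_on (Suc 0) S (\<lambda>z. Df z w)"
    by auto
  then have "\<forall>w. \<exists>D. (\<forall>z\<in>S. ((\<lambda>z. Df z w) has_derivative D z) (at z within S)) \<and>
      (\<forall>v. continuous_on S (\<lambda>z. D z v))"
    by simp
  then obtain DDf where "\<forall>w. (\<forall>z\<in>S. ((\<lambda>z. Df z w) has_derivative DDf w z) (at z within S)) \<and>
      (\<forall>v. continuous_on S (\<lambda>z. DDf w z v))"
    by metis
  with Df(1) show thesis using that unfolding is_jet2_def by blast
qed

lemma has_derivative_slice_space:
  assumes g: "(g has_derivative Dg) (at (t, y) within I \<times> V)" and V: "open V" "y \<in> V" and t: "t \<in> I"
  shows "((\<lambda>y. g (t, y)) has_derivative (\<lambda>v. Dg (0, v))) (at y)"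
proof -
  have "((\<lambda>y. (t, y)) has_derivative (\<lambda>v. (0, v))) (at y within V)"
    by (auto intro!: derivative_eq_intros)
  moreover have "(g has_derivative Dg) (at (t, y) within (\<lambda>y. (t, y)) ` V)"
    by (rule has_derivative_subset[OF g]) (use t in auto)
  ultimately have "((\<lambda>y. g (t, y)) has_derivative (\<lambda>v. Dg (0, v))) (at y within V)"
    by (rule has_derivative_in_compose)
  then show ?thesis by (simp only: at_within_open[OF V(2,1)])
qed

lemma has_vector_derivative_slice_time:
  assumes g: "(g has_derivative Dg) (at (t, y) within I \<times> V)" and "y \<in> V" and "J \<subseteq> I"
  shows "((\<lambda>s. g (s, y)) has_vector_derivative Dg (1, 0)) (at t within J)"
  using has_vector_derivative_along_line[of g Dg "(0, y)" t "(1, 0)" "I \<times> V" J] assms by auto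

lemma has_derivative_inner_const:
  assumes "(f has_derivative f') (at y)" "(g has_derivative g') (at y)"
    and "open V" "y \<in> V" "\<And>x. x \<in> V \<Longrightarrow> f x \<bullet> g x = k"
  shows "f y \<bullet> g' v + f' v \<bullet> g y = 0"
proof -
  have "((\<lambda>x. f x \<bullet> g x) has_derivative (\<lambda>v. f y \<bullet> g' v + f' v \<bullet> g y)) (at y)"
    by (rule has_derivative_inner[OF assms(1,2)])
  moreover have "((\<lambda>x. f x \<bullet> g x) has_derivative (\<lambda>v. 0)) (at y)"
    by (rule has_derivative_transform_within_open[of "\<lambda>x. k"]) (use assms in auto)
  ultimately have "(\<lambda>v. f y \<bullet> g' v + f' v \<bullet> g y) = (\<lambda>v. 0)"
    by (rule has_derivative_unique)
  then show ?thesis by (rule fun_cong)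
qed

text \<open>The matrix is the Jacobian of the transition map at \<open>p\<close>, by the chain rule.
  It is obtained before \<open>f\<close> is given, so the same matrix serves for the immersions at
  all times.\<close>

lemma pd_change_chart:
  fixes A :: "('m::{t2_space, second_countable_topology}, 'n::finite) chart set"
  assumes A: "smooth_atlas A" and c: "c \<in> A" "p \<in> fst c" and d: "d \<in> A" "p \<in> fst d"
  obtains J :: "real ^ 'n ^ 'n"
  where "\<And>(f :: 'm \<Rightarrow> 'b::real_normed_vector) i. (f \<circ> chart_inv c) differentiable (at (snd c p)) \<Longrightarrow>
     pd d f i p = (\<Sum>j\<in>UNIV. J $ j $ i *\<^sub>R pd c f j p)"
proof -
  have ic: "is_chart c" "is_chart d" using A c d by (auto simp: smooth_atlas_def)
  note C = is_chartD[OF ic(1)] and D = is_chartD[OF ic(2)]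
  define W where "W = snd d ` (fst d \<inter> fst c)"
  define \<phi> where "\<phi> = snd c \<circ> chart_inv d"
  have "W = snd d ` fst d \<inter> chart_inv d -` fst c"
    using D(5,6,7) by (auto simp: W_def)
  then have W: "open W"
    using continuous_open_preimage[OF D(4) D(2) C(1)] by simp
  have yW: "snd d p \<in> W" using c d by (auto simp: W_def)
  have "smooth_on W \<phi>"
    using A c d unfolding smooth_atlas_def W_def \<phi>_def by blast
  then have "ck_on (Suc 0) W \<phi>" unfolding smooth_on_def ..
  then obtain \<phi>' where "\<And>y. y \<in> W \<Longrightarrow> (\<phi> has_derivative \<phi>' y) (at y within W)" by auto
  then have \<phi>': "(\<phi> has_derivative \<phi>' (snd d p)) (at (snd d p))"
    using W yW by (metis at_within_open)
  let ?L = "\<phi>' (snd d p)"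
  have \<phi>p: "\<phi> (snd d p) = snd c p" using D(5) d by (simp add: \<phi>_def)
  show thesis
  proof (rule that[of "matrix ?L"])
    fix f :: "'m \<Rightarrow> 'b" and i
    let ?D = "frechet_derivative (f \<circ> chart_inv c) (at (snd c p))"
    assume "(f \<circ> chart_inv c) differentiable (at (snd c p))"
    then have "((f \<circ> chart_inv c) has_derivative ?D) (at (snd c p))"
      by (simp add: frechet_derivative_works)
    then have fd: "((f \<circ> chart_inv c) has_derivative ?D) (at (\<phi> (snd d p)))" by (simp add: \<phi>p)
    have "((f \<circ> chart_inv c) \<circ> \<phi> has_derivative ?D \<circ> ?L) (at (snd d p))"
      by (rule diff_chain_at[OF \<phi>' fd])
    then have "((f \<circ> chart_inv d) has_derivative ?D \<circ> ?L) (at (snd d p))"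
      by (rule has_derivative_transform_within_open[OF _ W yW])
         (use C(5) D(5) in \<open>auto simp: W_def \<phi>_def\<close>)
    then have "pd d f i p = ?D (?L (axis i 1))"
      by (simp add: pd_def frechet_derivative_at[symmetric])
    also have "?L (axis i 1) = (\<Sum>j\<in>UNIV. (?L (axis i 1) $ j) *\<^sub>R axis j 1)"
      by (simp add: vec_eq_iff axis_def if_distrib cong: if_cong)
    also have "?D \<dots> = (\<Sum>j\<in>UNIV. (?L (axis i 1) $ j) *\<^sub>R ?D (axis j 1))"
      using has_derivative_linear[OF fd] by (simp add: linear_sum linear_scale)
    also have "\<dots> = (\<Sum>j\<in>UNIV. matrix ?L $ j $ i *\<^sub>R pd c f j p)"
      by (simp add: matrix_def pd_def)
    finally show "pd d f i p = (\<Sum>j\<in>UNIV. matrix ?L $ j $ i *\<^sub>R pd c f j p)" .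
  qed
qed

text \<open>The metric transforms into J^T g J, so its determinant is multiplied by (det J)^2. This
  factor is common to all \<open>f\<close>, which lets a conservation law in one chart pass to
  another.\<close>

lemma metric_change_chart:
  fixes A :: "('m::{t2_space, second_countable_topology}, 'n::finite) chart set"
  assumes A: "smooth_atlas A" and c: "c \<in> A" "p \<in> fst c" and d: "d \<in> A" "p \<in> fst d"
  obtains a :: real
  where "\<And>f :: 'm \<Rightarrow> real ^ 'k::finite. (f \<circ> chart_inv c) differentiable (at (snd c p)) \<Longrightarrow>
     det (metric d f p) = a * det (metric c f p)"
proof -
  obtain J :: "real ^ 'n ^ 'n" where J: "\<And>(f :: 'm \<Rightarrow> real ^ 'k) i. (f \<circ> chart_inv c) differentiable (at (snd c p)) \<Longrightarrow>
     pd d f i p = (\<Sum>j\<in>UNIV. J $ j $ i *\<^sub>R pd c f j p)"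
    using pd_change_chart[OF A c d] by blast
  have "metric d f p = transpose J ** (metric c f p ** J)"
    if "(f \<circ> chart_inv c) differentiable (at (snd c p))" for f :: "'m \<Rightarrow> real ^ 'k"
    unfolding vec_eq_iff
  proof (intro allI)
    fix i j
    have "metric d f p $ i $ j = (\<Sum>k\<in>UNIV. \<Sum>l\<in>UNIV. J $ k $ i * (J $ l $ j * (pd c f k p \<bullet> pd c f l p)))"
      by (subst sum.swap) (simp add: metric_def J[OF that] inner_sum_left inner_sum_right sum_distrib_left mult_ac)
    then show "metric d f p $ i $ j = (transpose J ** (metric c f p ** J)) $ i $ j"
      by (simp add: metric_def matrix_matrix_mult_def transpose_def sum_distrib_left mult_ac)
  qed
  then have "det (metric d f p) = det J * det J * det (metric c f p)"
    if "(f \<circ> chart_inv c) differentiable (at (snd c p))" for f :: "'m \<Rightarrow> real ^ 'k"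
    using that by (simp add: det_mul)
  then show thesis by (rule that)
qed

subsection \<open>Space-time jets of the flow\<close>

locale hmcf =
  fixes A :: "('m::{t2_space, second_countable_topology}, 'n::finite) chart set"
    and T :: ereal
    and F \<nu> :: "real \<Rightarrow> 'm \<Rightarrow> real ^ 'k::finite"
  assumes atlas: "smooth_atlas A"
    and codim: "CARD('k) = CARD('n) + 1"
    and T_pos: "0 < T"
    and sol: "hmcf_solution A T F \<nu>"
begin

abbreviation "I \<equiv> time_dom T"
abbreviation "e \<equiv> energy_density A T F"
abbreviation "\<sigma> \<equiv> normal_speed T F \<nu>"
abbreviation "H t \<equiv> mean_curvature A (F t) (\<nu> t)"

lemma zero_I: "0 \<in> I" using T_pos by (simp add: time_dom_def zero_ereal_def)

lemma evolution:
  "t \<in> I \<Longrightarrow> dt T (dt T F) t p = (e t p * H t p) *\<^sub>R \<nu> t p - gradient A (F t) (e t) p"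
  using sol by (simp add: hmcf_solution_def)

lemma chart_at_mem: "chart_at A p \<in> A" "p \<in> fst (chart_at A p)"
proof -
  have "\<exists>c. c \<in> A \<and> p \<in> fst c" using atlas unfolding smooth_atlas_def by blast
  from someI_ex[OF this] show "chart_at A p \<in> A" "p \<in> fst (chart_at A p)"
    by (simp_all add: chart_at_def)
qed

lemma is_chart: "c \<in> A \<Longrightarrow> is_chart c"
  using atlas by (simp add: smooth_atlas_def)

lemma norm_normal: "t \<in> I \<Longrightarrow> norm (\<nu> t p) = 1"
  and normal_orthogonal: "t \<in> I \<Longrightarrow> c \<in> A \<Longrightarrow> p \<in> fst c \<Longrightarrow> \<nu> t p \<bullet> pd c (F t) i p = 0"
  using sol by (auto simp: hmcf_solution_def is_unit_normal_def)

text \<open>The gradient is a combination of tangent vectors and drops out against the normal. Read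
  from right to left, the identity describes e H without the chart selected at
  \<open>p\<close>.\<close>

lemma acceleration_normal:
  assumes "t \<in> I"
  shows "dt T (dt T F) t p \<bullet> \<nu> t p = e t p * H t p"
proof -
  have "\<nu> t p \<bullet> gradient A (F t) (e t) p = 0"
    using normal_orthogonal[OF assms chart_at_mem, of p]
    by (simp add: gradient_def Let_def inner_sum_right)
  moreover have "\<nu> t p \<bullet> \<nu> t p = 1"
    using norm_normal[OF assms, of p] by (simp add: dot_square_norm)
  ultimately have "\<nu> t p \<bullet> dt T (dt T F) t p = e t p * H t p"
    by (simp add: evolution[OF assms] inner_diff_right)
  then show ?thesis by (simp only: inner_commute)
qed

end

text \<open>
  \<open>DF\<close>, \<open>DDF\<close> are the first and second derivatives of \<open>F\<close> in the space-time coordinates of the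
  chart \<open>c\<close>; \<open>DDF w z v\<close> differentiates first in the direction \<open>w\<close>, then in the direction \<open>v\<close>.
\<close>

locale hmcf_chart = hmcf A T F \<nu>
  for A :: "('m::{t2_space, second_countable_topology}, 'n::finite) chart set"
    and T :: ereal
    and F \<nu> :: "real \<Rightarrow> 'm \<Rightarrow> real ^ 'k::finite" +
  fixes c :: "('m, 'n) chart"
    and DF DN :: "real \<times> (real ^ 'n) \<Rightarrow> real \<times> (real ^ 'n) \<Rightarrow> real ^ 'k"
    and DDF DDN :: "real \<times> (real ^ 'n) \<Rightarrow> real \<times> (real ^ 'n) \<Rightarrow> real \<times> (real ^ 'n) \<Rightarrow> real ^ 'k"
  assumes chart_mem: "c \<in> A"
    and jetF: "is_jet2 (time_dom T \<times> snd c ` fst c) (\<lambda>(t, y). F t (chart_inv c y)) DF DDF"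
    and jetN: "is_jet2 (time_dom T \<times> snd c ` fst c) (\<lambda>(t, y). \<nu> t (chart_inv c y)) DN DDN"
begin

abbreviation "V \<equiv> snd c ` fst c"
abbreviation "point \<equiv> chart_inv c"
abbreviation "P z \<equiv> DF z (1, 0)"
abbreviation "Q i z \<equiv> DF z (0, axis i 1)"
abbreviation "N z \<equiv> \<nu> (fst z) (point (snd z))"

lemmas chart = is_chartD[OF is_chart[OF chart_mem]]

lemma
  assumes z: "z \<in> I \<times> V"
  shows derF: "((\<lambda>z. F (fst z) (point (snd z))) has_derivative DF z) (at z within I \<times> V)"
    and derN: "(N has_derivative DN z) (at z within I \<times> V)"
    and derDF: "((\<lambda>z. DF z w) has_derivative DDF w z) (at z within I \<times> V)"
  using jetF jetN z unfolding is_jet2_def case_prod_unfold by blast+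

lemma cont_DDF: "continuous_on (I \<times> V) (\<lambda>z. DDF w z v)"
  using jetF unfolding is_jet2_def by blast

lemma velocity:
  assumes "t \<in> I" "y \<in> V"
  shows "dt T F t (point y) = P (t, y)"
  unfolding dt_def
  using has_vector_derivative_slice_time[OF derF, of t y I] assms
  by (intro vector_derivative_within at_within_time_dom_nonbot) auto

lemma acceleration:
  assumes "t \<in> I" "y \<in> V"
  shows "dt T (dt T F) t (point y) = DDF (1, 0) (t, y) (1, 0)"
proof -
  have "((\<lambda>s. P (s, y)) has_vector_derivative DDF (1, 0) (t, y) (1, 0)) (at t within I)"
    using has_vector_derivative_slice_time[OF derDF, of t y I] assms by auto
  then have "((\<lambda>s. dt T F s (point y)) has_vector_derivative DDF (1, 0) (t, y) (1, 0)) (at t within I)"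
    by (rule has_vector_derivative_transform[rotated 2]) (use assms velocity in auto)
  then show ?thesis
    unfolding dt_def[of T "dt T F"]
    by (intro vector_derivative_within at_within_time_dom_nonbot assms)
qed

lemma has_derivative_F_point:
  assumes "t \<in> I" "y \<in> V"
  shows "((F t \<circ> point) has_derivative (\<lambda>v. DF (t, y) (0, v))) (at y)"
  using has_derivative_slice_space[OF derF chart(2), of t y] assms by (simp add: o_def)

lemma pd_F:
  assumes "t \<in> I" "y \<in> V"
  shows "pd c (F t) i (point y) = Q i (t, y)"
  using frechet_derivative_at[OF has_derivative_F_point[OF assms]] chart(6)[OF assms(2)]
  by (metis pd_def)

lemma pd_normal:
  assumes "t \<in> I" "y \<in> V"
  shows "pd c (\<nu> t) i (point y) = DN (t, y) (0, axis i 1)"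
proof -
  have "((\<nu> t \<circ> point) has_derivative (\<lambda>v. DN (t, y) (0, v))) (at y)"
    using has_derivative_slice_space[OF derN chart(2), of t y] assms by (simp add: o_def)
  then show ?thesis
    using frechet_derivative_at[of "\<nu> t \<circ> point"] chart(6)[OF assms(2)] by (metis pd_def)
qed

lemma energy_chart:
  assumes "t \<in> I" "y \<in> V"
  shows "e t (point y) = (P (t, y) \<bullet> P (t, y) + real CARD('n)) / 2"
  by (simp add: energy_density_def velocity[OF assms] dot_square_norm)

lemma pd_energy:
  assumes "t \<in> I" "y \<in> V"
  shows "pd c (e t) i (point y) = P (t, y) \<bullet> DDF (1, 0) (t, y) (0, axis i 1)"
proof -
  have d: "((\<lambda>y. P (t, y)) has_derivative (\<lambda>v. DDF (1, 0) (t, y) (0, v))) (at y)"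
    using has_derivative_slice_space[OF derDF chart(2), of t y] assms by simp
  have "((\<lambda>y. (P (t, y) \<bullet> P (t, y) + real CARD('n)) / 2) has_derivative
      (\<lambda>v. P (t, y) \<bullet> DDF (1, 0) (t, y) (0, v))) (at y)"
  proof (rule has_derivative_eq_rhs)
    show "((\<lambda>y. (P (t, y) \<bullet> P (t, y) + real CARD('n)) / 2) has_derivative
      (\<lambda>v. (P (t, y) \<bullet> DDF (1, 0) (t, y) (0, v) + DDF (1, 0) (t, y) (0, v) \<bullet> P (t, y) + 0) / 2)) (at y)"
      by (rule bounded_linear.has_derivative[OF bounded_linear_divide]
          has_derivative_add has_derivative_inner has_derivative_const d)+
  qed (auto simp: inner_commute)
  then have "((e t \<circ> point) has_derivative (\<lambda>v. P (t, y) \<bullet> DDF (1, 0) (t, y) (0, v))) (at y)"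
    by (rule has_derivative_transform_within_open[OF _ chart(2)]) (use assms energy_chart in auto)
  then show ?thesis
    using frechet_derivative_at[of "e t \<circ> point"] chart(6)[OF assms(2)] by (metis pd_def)
qed

lemma metric_chart:
  assumes "t \<in> I" "y \<in> V"
  shows "metric c (F t) (point y) = gram (\<lambda>i. Q i (t, y))"
  by (simp add: metric_def gram_def pd_F[OF assms])

lemma normal_props:
  assumes "t \<in> I" "y \<in> V"
  shows "N (t, y) \<bullet> N (t, y) = 1" "N (t, y) \<bullet> Q i (t, y) = 0"
  using norm_normal[OF assms(1)] normal_orthogonal[OF assms(1) chart_mem chart(7)[OF assms(2)], of i] pd_F[OF assms]
  by (auto simp: dot_square_norm)

lemma tangent_independent:
  assumes "t \<in> I" "y \<in> V" and x: "(\<Sum>i\<in>UNIV. x $ i *\<^sub>R Q i (t, y)) = 0"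
  shows "x = 0"
proof -
  have "immersion A (F t)" using sol assms(1) by (simp add: hmcf_solution_def)
  then have "inj (frechet_derivative (F t \<circ> point) (at y))"
    using chart_mem chart(6,7)[OF assms(2)] unfolding immersion_def by metis
  then have inj: "inj (\<lambda>v. DF (t, y) (0, v))"
    using frechet_derivative_at[OF has_derivative_F_point[OF assms(1,2)]] by simp
  have lin: "linear (\<lambda>v. DF (t, y) (0, v))"
    using has_derivative_linear[OF has_derivative_F_point[OF assms(1,2)]] .
  have "DF (t, y) (0, \<Sum>i\<in>UNIV. x $ i *\<^sub>R axis i 1) = (\<Sum>i\<in>UNIV. x $ i *\<^sub>R Q i (t, y))"
    using linear_sum[OF lin, of "\<lambda>i. x $ i *\<^sub>R axis i 1" UNIV] linear_scale[OF lin] by simp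
  moreover have "(\<Sum>i\<in>UNIV. x $ i *\<^sub>R axis i 1) = x"
    by (simp add: vec_eq_iff axis_def if_distrib cong: if_cong)
  ultimately have "DF (t, y) (0, x) = 0" using x by simp
  then show ?thesis using inj unfolding linear_injective_0[OF lin] by blast
qed

lemma invertible_metric:
  assumes "t \<in> I" "y \<in> V"
  shows "invertible (gram (\<lambda>i. Q i (t, y)))"
  by (rule invertible_gram) (rule tangent_independent[OF assms])

text \<open>The velocity of the tangent vector F_i is the i-th spatial derivative of the velocity of
  \<open>F\<close>. The order in \<open>DDF\<close> is thus time first, then space, which is also
  the order that occurs in the derivative of the energy density.\<close>

lemma tangent_time_derivative:
  assumes "b \<in> I" "t \<in> {0..b}" "y \<in> V"
  shows "((\<lambda>s. Q i (s, y)) has_vector_derivative DDF (1, 0) (t, y) (0, axis i 1)) (at t within {0..b})"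
  using assms time_dom_Icc[OF assms(1)]
  by (intro mixed_partial_derivative[OF derF derDF cont_DDF chart(2)]) auto

lemma velocity_time_derivative:
  assumes "b \<in> I" "t \<in> {0..b}" "y \<in> V"
  shows "((\<lambda>s. P (s, y)) has_vector_derivative DDF (1, 0) (t, y) (1, 0)) (at t within {0..b})"
  using assms time_dom_Icc[OF assms(1)] by (intro has_vector_derivative_slice_time[OF derDF]) auto

end

subsection \<open>Pointwise evolution\<close>

context hmcf_chart
begin

text \<open>
  Mean curvature and gradient are computed in the chart \<open>chart_at A\<close>, so identities that involve them
  in coordinates are first proved at points where this is the chart \<open>c\<close>.
\<close>

lemma gradient_energy_tangent:
  assumes z: "t \<in> I" "y \<in> V" and ad: "chart_at A (point y) = c"
  shows "gradient A (F t) (e t) (point y) \<bullet> Q k (t, y) = P (t, y) \<bullet> DDF (1, 0) (t, y) (0, axis k 1)"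
proof -
  let ?G = "gram (\<lambda>i. Q i (t, y))"
  let ?d = "\<lambda>j. P (t, y) \<bullet> DDF (1, 0) (t, y) (0, axis j 1)"
  have inv: "invertible ?G" by (rule invertible_metric[OF z])
  have tr: "transpose ?G = ?G" by (simp add: gram_def transpose_def vec_eq_iff inner_commute)
  have "gradient A (F t) (e t) (point y) \<bullet> Q k (t, y) =
      (\<Sum>i\<in>UNIV. \<Sum>j\<in>UNIV. matrix_inv ?G $ i $ j * ?d j * (?G $ i $ k))"
    by (simp add: gradient_def Let_def ad metric_chart[OF z] pd_F[OF z] pd_energy[OF z]
        inner_sum_left gram_def)
  \<comment> \<open>The index of the differential is raised by the inverse metric and lowered again
    by the metric. After use of symmetry the two contract to the identity.\<close>
  also have "\<dots> = (\<Sum>j\<in>UNIV. \<Sum>i\<in>UNIV. ?d j * (matrix_inv ?G $ j $ i * ?G $ i $ k))"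
    by (subst sum.swap)
       (intro sum.cong refl, simp add: matrix_inv_symmetric[OF inv tr] mult_ac)
  also have "\<dots> = (\<Sum>j\<in>UNIV. ?d j * (matrix_inv ?G ** ?G) $ j $ k)"
    by (simp add: matrix_matrix_mult_def sum_distrib_left)
  also have "\<dots> = ?d k"
    using matrix_inv_inverse[OF inv] by (simp add: mat_def if_distrib cong: if_cong)
  finally show ?thesis .
qed

lemma velocity_tangential_zero:
  assumes b: "b \<in> I" and y: "y \<in> V" and ad: "chart_at A (point y) = c"
  shows "P (b, y) \<bullet> Q k (b, y) = 0"
proof -
  have b0: "b \<ge> 0" using b by (simp add: time_dom_def)
  have I: "{0..b} \<subseteq> I" by (rule time_dom_Icc[OF b])
  have "((\<lambda>s. P (s, y) \<bullet> Q k (s, y)) has_vector_derivative 0) (at t within {0..b})"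
    if t: "t \<in> {0..b}" for t
  proof -
    have tI: "t \<in> I" using t I by auto
    have "dt T (dt T F) t (point y) \<bullet> Q k (t, y) = - (P (t, y) \<bullet> DDF (1, 0) (t, y) (0, axis k 1))"
      using normal_props(2)[OF tI y, of k]
      by (simp add: evolution[OF tI] inner_diff_left gradient_energy_tangent[OF tI y ad])
    then have "P (t, y) \<bullet> DDF (1, 0) (t, y) (0, axis k 1) + DDF (1, 0) (t, y) (1, 0) \<bullet> Q k (t, y) = 0"
      by (simp add: acceleration[OF tI y])
    then show ?thesis
      using bounded_bilinear.has_vector_derivative[OF bounded_bilinear_inner
          velocity_time_derivative[OF b t y] tangent_time_derivative[OF b t y, of k]] by simp
  qed
  then obtain a where a: "\<And>t. t \<in> {0..b} \<Longrightarrow> P (t, y) \<bullet> Q k (t, y) = a"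
    using has_vector_derivative_zero_constant[of "{0..b}" "\<lambda>s. P (s, y) \<bullet> Q k (s, y)"] by auto
  have "dt T F 0 (point y) = (dt T F 0 (point y) \<bullet> \<nu> 0 (point y)) *\<^sub>R \<nu> 0 (point y)"
    using sol by (simp add: hmcf_solution_def)
  then have "P (0, y) \<bullet> Q k (0, y) = 0"
    using normal_props(2)[OF zero_I y, of k] velocity[OF zero_I y]
    by (metis fst_conv snd_conv inner_scaleR_left mult_zero_right)
  then show ?thesis using a[of 0] a[of b] b0 by simp
qed

lemma velocity_normal_adapted:
  assumes "t \<in> I" "y \<in> V" "chart_at A (point y) = c"
  shows "dt T F t (point y) = \<sigma> t (point y) *\<^sub>R \<nu> t (point y)"
  using orthogonal_hyperplane_normal[where q="\<lambda>i. Q i (t, y)" and w="P (t, y)" and N="N (t, y)",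
      OF tangent_independent[OF assms(1,2)] codim]
    velocity_tangential_zero[OF assms] normal_props[OF assms(1,2)] velocity[OF assms(1,2)]
  by (simp add: norm_eq_sqrt_inner normal_speed_def)

end

section \<open>Normality of the velocity; evolution of speed and energy density\<close>

context hmcf
begin

lemma chart_jets:
  assumes "c \<in> A"
  obtains DF DN DDF DDN where "hmcf_chart A T F \<nu> c DF DN DDF DDN"
proof -
  have "smooth_on (I \<times> snd c ` fst c) (\<lambda>(t, y). F t (chart_inv c y))"
    "smooth_on (I \<times> snd c ` fst c) (\<lambda>(t, y). \<nu> t (chart_inv c y))"
    using sol assms by (auto simp: hmcf_solution_def smooth_family_def)
  then show thesis
    using that assms by (metis smooth_on_jet2 hmcf_chart.intro hmcf_chart_axioms.intro hmcf_axioms)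
qed

lemma velocity_normal:
  assumes t: "t \<in> I"
  shows "dt T F t p = \<sigma> t p *\<^sub>R \<nu> t p"
proof -
  define c where "c = chart_at A p"
  have c: "c \<in> A" "p \<in> fst c" using chart_at_mem by (auto simp: c_def)
  obtain DF DN DDF DDN where "hmcf_chart A T F \<nu> c DF DN DDF DDN" using chart_jets[OF c(1)] .
  then interpret hmcf_chart A T F \<nu> c DF DN DDF DDN .
  show ?thesis
    using velocity_normal_adapted[OF t, of "snd c p"] chart(5)[OF c(2)] c by (simp add: c_def)
qed

lemma energy_speed:
  assumes "t \<in> I"
  shows "e t p = ((\<sigma> t p)\<^sup>2 + real CARD('n)) / 2"
  by (simp add: energy_density_def velocity_normal[OF assms] norm_normal[OF assms])

text \<open>The derivative of a unit vector field is orthogonal to it, and the velocity is a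
  multiple of \<nu>. Hence the term <\<partial>_t F, \<partial>_t \<nu>> vanishes and only the
  normal component of the acceleration remains.\<close>

lemma speed_derivative:
  assumes b: "b \<in> I" and t: "t \<in> {0..b}"
  shows "((\<lambda>s. \<sigma> s p) has_real_derivative e t p * H t p) (at t within {0..b})"
proof -
  define c where "c = chart_at A p"
  have c: "c \<in> A" "p \<in> fst c" using chart_at_mem by (auto simp: c_def)
  obtain DF DN DDF DDN where "hmcf_chart A T F \<nu> c DF DN DDF DDN" using chart_jets[OF c(1)] .
  then interpret hmcf_chart A T F \<nu> c DF DN DDF DDN .
  define y where "y = snd c p"
  have y: "y \<in> V" "point y = p" using c chart(5) by (auto simp: y_def)
  have I: "{0..b} \<subseteq> I" by (rule time_dom_Icc[OF b])
  then have tI: "t \<in> I" using t by auto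
  have dN: "((\<lambda>s. N (s, y)) has_vector_derivative DN (t, y) (1, 0)) (at t within J)" if "J \<subseteq> I" for J
    using has_vector_derivative_slice_time[OF derN, of t y J] that tI y by simp
  have "((\<lambda>s. N (s, y) \<bullet> N (s, y)) has_vector_derivative
      N (t, y) \<bullet> DN (t, y) (1, 0) + DN (t, y) (1, 0) \<bullet> N (t, y)) (at t within I)"
    by (rule bounded_bilinear.has_vector_derivative[OF bounded_bilinear_inner dN[OF subset_refl] dN[OF subset_refl]])
  moreover have "((\<lambda>s. N (s, y) \<bullet> N (s, y)) has_vector_derivative 0) (at t within I)"
    by (rule has_vector_derivative_transform[OF tI _ has_vector_derivative_const[of 1]])
       (use normal_props(1) y in auto)
  ultimately have "N (t, y) \<bullet> DN (t, y) (1, 0) + DN (t, y) (1, 0) \<bullet> N (t, y) = 0"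
    using vector_derivative_unique_within[OF at_within_time_dom_nonbot[OF tI]] by blast
  then have "\<nu> t p \<bullet> DN (t, y) (1, 0) = 0"
    using y(2) by (simp add: inner_commute)
  moreover have "P (t, y) = \<sigma> t p *\<^sub>R \<nu> t p"
    using velocity_normal[OF tI, of p] velocity[OF tI y(1)] y(2) by simp
  ultimately have "P (t, y) \<bullet> DN (t, y) (1, 0) = 0" by simp
  moreover have "DDF (1, 0) (t, y) (1, 0) \<bullet> N (t, y) = e t p * H t p"
    using acceleration_normal[OF tI, of p] acceleration[OF tI y(1)] y(2) by simp
  ultimately have "((\<lambda>s. P (s, y) \<bullet> N (s, y)) has_vector_derivative e t p * H t p) (at t within {0..b})"
    using bounded_bilinear.has_vector_derivative[OF bounded_bilinear_inner
        velocity_time_derivative[OF b t y(1)] dN[OF I]] by simp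
  then have "((\<lambda>s. \<sigma> s p) has_vector_derivative e t p * H t p) (at t within {0..b})"
    by (rule has_vector_derivative_transform[OF t, rotated])
       (use I y velocity in \<open>auto simp: normal_speed_def\<close>)
  then show ?thesis by (simp add: has_real_derivative_iff_has_vector_derivative)
qed

lemma energy_derivative:
  assumes b: "b \<in> I" and t: "t \<in> {0..b}"
  shows "((\<lambda>s. e s p) has_real_derivative \<sigma> t p * (e t p * H t p)) (at t within {0..b})"
proof -
  have "((\<lambda>s. ((\<sigma> s p)\<^sup>2 + real CARD('n)) / 2) has_real_derivative \<sigma> t p * (e t p * H t p)) (at t within {0..b})"
    by (auto intro!: derivative_eq_intros speed_derivative[OF assms])
  then show ?thesis
    by (rule has_field_derivative_transform_within[OF _ zero_less_one t])
       (use energy_speed time_dom_Icc[OF b] in \<open>auto simp: subset_iff\<close>)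
qed

end

section \<open>Evolution of the induced metric and conservation of e^2 det g in a chart\<close>

context hmcf_chart
begin

text \<open>Both <\<partial>_t F, F_j> and <\<nu>, F_j> vanish identically in space. Differentiating
  them in direction i produces the same vector of second derivatives of \<open>F\<close>, tested
  once against \<sigma> \<nu> and once against \<nu>. Comparison gives the factor \<sigma>, and no
  spatial derivative of \<sigma> enters.\<close>

lemma tangent_derivative_shape:
  assumes z: "t \<in> I" "y \<in> V"
  shows "DDF (1, 0) (t, y) (0, axis i 1) \<bullet> Q j (t, y) = \<sigma> t (point y) * (DN (t, y) (0, axis i 1) \<bullet> Q j (t, y))"
proof -
  have PN: "P (t, x) = \<sigma> t (point x) *\<^sub>R N (t, x)" if "x \<in> V" for x
    using velocity_normal[OF z(1), of "point x"] velocity[OF z(1) that] by simp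
  have dP: "((\<lambda>y. P (t, y)) has_derivative (\<lambda>v. DDF (1, 0) (t, y) (0, v))) (at y)"
    and dQ: "((\<lambda>y. Q j (t, y)) has_derivative (\<lambda>v. DDF (0, axis j 1) (t, y) (0, v))) (at y)"
    using has_derivative_slice_space[OF derDF chart(2) z(2) z(1)] z by auto
  have dN: "((\<lambda>y. N (t, y)) has_derivative (\<lambda>v. DN (t, y) (0, v))) (at y)"
    using has_derivative_slice_space[OF derN chart(2) z(2) z(1)] z by auto
  have "P (t, y) \<bullet> DDF (0, axis j 1) (t, y) (0, axis i 1) + DDF (1, 0) (t, y) (0, axis i 1) \<bullet> Q j (t, y) = 0"
    by (rule has_derivative_inner_const[OF dP dQ chart(2) z(2), of 0])
       (use PN normal_props(2)[OF z(1)] in simp)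
  moreover have "N (t, y) \<bullet> DDF (0, axis j 1) (t, y) (0, axis i 1) + DN (t, y) (0, axis i 1) \<bullet> Q j (t, y) = 0"
    by (rule has_derivative_inner_const[OF dN dQ chart(2) z(2), of 0])
       (use normal_props(2)[OF z(1)] in simp)
  ultimately have "DDF (1, 0) (t, y) (0, axis i 1) \<bullet> Q j (t, y) = - (P (t, y) \<bullet> DDF (0, axis j 1) (t, y) (0, axis i 1))"
    "DN (t, y) (0, axis i 1) \<bullet> Q j (t, y) = - (N (t, y) \<bullet> DDF (0, axis j 1) (t, y) (0, axis i 1))"
    by linarith+
  then show ?thesis by (simp add: PN[OF z(2)])
qed

lemma det_metric_derivative:
  assumes b: "b \<in> I" and t: "t \<in> {0..b}" and y: "y \<in> V" and ad: "chart_at A (point y) = c"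
  shows "((\<lambda>s. det (metric c (F s) (point y))) has_real_derivative
     det (metric c (F t) (point y)) * (-2 * \<sigma> t (point y) * H t (point y))) (at t within {0..b})"
proof -
  have I: "{0..b} \<subseteq> I" by (rule time_dom_Icc[OF b])
  then have tI: "t \<in> I" using t by auto
  let ?G = "\<lambda>s. gram (\<lambda>i. Q i (s, y))"
  let ?s = "\<sigma> t (point y)"
  let ?h = "\<lambda>i j. - (Q i (t, y) \<bullet> DN (t, y) (0, axis j 1))"
  \<comment> \<open>The time derivative of the metric. It contains the second fundamental form with
    its indices in both orders; contracted with the symmetric inverse metric each order gives H,
    whence the factor 2.\<close>
  define D where "D = (\<chi> i j. - ?s * (?h i j + ?h j i))"
  have inv: "invertible (?G t)" by (rule invertible_metric[OF tI y])
  have tr: "transpose (?G t) = ?G t" by (simp add: gram_def transpose_def vec_eq_iff inner_commute)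
  have "((\<lambda>s. ?G s $ i $ j) has_real_derivative D $ i $ j) (at t within {0..b})" for i j
  proof -
    have "Q i (t, y) \<bullet> DDF (1, 0) (t, y) (0, axis j 1) + DDF (1, 0) (t, y) (0, axis i 1) \<bullet> Q j (t, y) = D $ i $ j"
      using tangent_derivative_shape[OF tI y, of i j] tangent_derivative_shape[OF tI y, of j i]
      by (simp add: D_def inner_commute algebra_simps)
    then show ?thesis
      using bounded_bilinear.has_vector_derivative[OF bounded_bilinear_inner
          tangent_time_derivative[OF b t y, of i] tangent_time_derivative[OF b t y, of j]]
      by (simp add: gram_def has_real_derivative_iff_has_vector_derivative)
  qed
  then have d: "((\<lambda>s. det (?G s)) has_real_derivative
     det (?G t) * (\<Sum>i\<in>UNIV. \<Sum>j\<in>UNIV. matrix_inv (?G t) $ i $ j * D $ j $ i)) (at t within {0..b})"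
    by (rule det_has_derivative) (rule inv)
  let ?M = "matrix_inv (?G t)"
  have H: "H t (point y) = (\<Sum>i\<in>UNIV. \<Sum>j\<in>UNIV. ?M $ i $ j * ?h i j)"
    by (simp add: mean_curvature_def Let_def ad metric_chart[OF tI y] second_ff_def pd_F[OF tI y] pd_normal[OF tI y])
  moreover have "(\<Sum>i\<in>UNIV. \<Sum>j\<in>UNIV. ?M $ i $ j * ?h i j) = (\<Sum>i\<in>UNIV. \<Sum>j\<in>UNIV. ?M $ i $ j * ?h j i)"
    by (subst sum.swap) (simp add: matrix_inv_symmetric[OF inv tr])
  moreover have "(\<Sum>i\<in>UNIV. \<Sum>j\<in>UNIV. ?M $ i $ j * D $ j $ i) =
      - ?s * ((\<Sum>i\<in>UNIV. \<Sum>j\<in>UNIV. ?M $ i $ j * ?h i j) + (\<Sum>i\<in>UNIV. \<Sum>j\<in>UNIV. ?M $ i $ j * ?h j i))"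
    unfolding D_def sum.distrib[symmetric] sum_distrib_left
    by (intro sum.cong refl) (simp add: algebra_simps)
  ultimately have "(\<Sum>i\<in>UNIV. \<Sum>j\<in>UNIV. ?M $ i $ j * D $ j $ i) = -2 * ?s * H t (point y)"
    by simp
  with d have "((\<lambda>s. det (?G s)) has_real_derivative det (?G t) * (-2 * ?s * H t (point y))) (at t within {0..b})"
    by simp
  then show ?thesis
    unfolding metric_chart[OF tI y]
    by (rule has_field_derivative_transform_within[OF _ zero_less_one t]) (use metric_chart[OF _ y] I in auto)
qed

text \<open>This is the square of the coordinate density e sqrt(det g), so no root has to be
  differentiated: the factor e^2 contributes 2 \<sigma> H e^2 det g and the determinant the opposite
  amount.\<close>

lemma energy_volume_adapted:
  assumes b: "b \<in> I" and y: "y \<in> V" and ad: "chart_at A (point y) = c"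
  shows "(e b (point y))\<^sup>2 * det (metric c (F b) (point y)) = (e 0 (point y))\<^sup>2 * det (metric c (F 0) (point y))"
proof -
  let ?f = "\<lambda>s. (e s (point y))\<^sup>2 * det (metric c (F s) (point y))"
  have "(?f has_real_derivative 0) (at t within {0..b})" if t: "t \<in> {0..b}" for t
    by (rule derivative_eq_intros energy_derivative[OF b t] det_metric_derivative[OF b t y ad] refl)+
       (simp add: power2_eq_square algebra_simps)
  then obtain k where "\<And>t. t \<in> {0..b} \<Longrightarrow> ?f t = k"
    using has_field_derivative_zero_constant[of "{0..b}" ?f] by auto
  from this[of 0] this[of b] show ?thesis using b by (simp add: time_dom_def)
qed

lemma F_point_differentiable: "t \<in> I \<Longrightarrow> y \<in> V \<Longrightarrow> (F t \<circ> point) differentiable (at y)"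
  using has_derivative_F_point unfolding differentiable_def by blast

lemma continuous_det_metric:
  assumes t: "t \<in> I"
  shows "continuous_on V (\<lambda>y. det (metric c (F t) (point y)))"
proof -
  have "((\<lambda>y. Q i (t, y)) has_derivative (\<lambda>v. DDF (0, axis i 1) (t, y) (0, v))) (at y)" if "y \<in> V" for i y
    using has_derivative_slice_space[OF derDF chart(2) that t] that t by auto
  then have [continuous_intros]: "continuous_on V (\<lambda>y. Q i (t, y))" for i
    by (meson continuous_at_imp_continuous_on has_derivative_continuous)
  have "continuous_on V (\<lambda>y. det (gram (\<lambda>i. Q i (t, y))))"
    unfolding det_def gram_def vec_lambda_beta by (intro continuous_intros)
  then show ?thesis
    by (rule continuous_on_cong[THEN iffD1, rotated 2]) (use metric_chart[OF t] in auto)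
qed

lemma continuous_acceleration_chart:
  "continuous_on (I \<times> fst c) (\<lambda>(t, p). dt T (dt T F) t p \<bullet> \<nu> t p)"
proof -
  have "continuous_on (I \<times> V) N"
    using derN has_derivative_continuous continuous_on_eq_continuous_within by blast
  then have c1: "continuous_on (I \<times> V) (\<lambda>z. DDF (1, 0) z (1, 0) \<bullet> N z)"
    by (intro continuous_on_inner cont_DDF)
  have "continuous_on (I \<times> fst c) ((\<lambda>z. DDF (1, 0) z (1, 0) \<bullet> N z) \<circ> (\<lambda>z. (fst z, snd c (snd z))))"
    by (rule continuous_on_compose)
       (auto intro!: continuous_intros continuous_on_compose2[OF chart(3)] continuous_on_subset[OF c1])
  then show ?thesis
    by (rule continuous_on_cong[THEN iffD1, rotated 2]) (use acceleration chart(5) in force)+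
qed

end

context hmcf
begin

text \<open>At \<open>p\<close> the law is known in the chart selected there. Passing to the chart
  \<open>d\<close> multiplies both sides by one and the same factor. All points of \<open>d\<close>
  are needed in a single chart to compare the measures.\<close>

lemma energy_volume_constant:
  assumes d: "d \<in> A" "p \<in> fst d" and t: "t \<in> I"
  shows "(e t p)\<^sup>2 * det (metric d (F t) p) = (e 0 p)\<^sup>2 * det (metric d (F 0) p)"
proof -
  define c where "c = chart_at A p"
  have c: "c \<in> A" "p \<in> fst c" using chart_at_mem by (auto simp: c_def)
  obtain DF DN DDF DDN where "hmcf_chart A T F \<nu> c DF DN DDF DDN" using chart_jets[OF c(1)] .
  then interpret hmcf_chart A T F \<nu> c DF DN DDF DDN .
  obtain a where a: "\<And>f :: 'm \<Rightarrow> real ^ 'k. (f \<circ> chart_inv c) differentiable (at (snd c p)) \<Longrightarrow>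
     det (metric d f p) = a * det (metric c f p)"
    using metric_change_chart[OF atlas c d] by blast
  have "(e t p)\<^sup>2 * det (metric c (F t) p) = (e 0 p)\<^sup>2 * det (metric c (F 0) p)"
    using energy_volume_adapted[OF t, of "snd c p"] chart(5)[OF c(2)] c by (simp add: c_def)
  then show ?thesis
    using a[OF F_point_differentiable] t zero_I c by (simp add: mult.left_commute[of _ a])
qed

text \<open>Continuity is local and chart domains are open, so each point is handled in its own
  chart. By \<open>acceleration_normal\<close> this is the joint continuity of e H, which the
  pointwise choice of charts in the definition of H conceals.\<close>

lemma continuous_acceleration:
  "continuous_on (I \<times> UNIV) (\<lambda>(t, p). dt T (dt T F) t p \<bullet> \<nu> t p)"
  unfolding continuous_on_eq_continuous_within
proof
  fix z :: "real \<times> 'm" assume z: "z \<in> I \<times> UNIV"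
  define c where "c = chart_at A (snd z)"
  have c: "c \<in> A" "snd z \<in> fst c" using chart_at_mem by (auto simp: c_def)
  obtain DF DN DDF DDN where "hmcf_chart A T F \<nu> c DF DN DDF DDN" using chart_jets[OF c(1)] .
  then interpret hmcf_chart A T F \<nu> c DF DN DDF DDN .
  have "continuous (at z within I \<times> fst c) (\<lambda>(t, p). dt T (dt T F) t p \<bullet> \<nu> t p)"
    using continuous_acceleration_chart z c(2) by (auto simp: continuous_on_eq_continuous_within)
  moreover have "at z within I \<times> fst c = at z within I \<times> UNIV"
    by (rule at_within_nhd[of z "UNIV \<times> fst c"]) (use c(2) chart(1) in \<open>auto simp: open_Times mem_Times_iff\<close>)
  ultimately show "continuous (at z within I \<times> UNIV) (\<lambda>(t, p). dt T (dt T F) t p \<bullet> \<nu> t p)" by simp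
qed

end

subsection \<open>The flux function and the volume measure\<close>

lemma arctan_plus_le:
  fixes x :: real
  shows "\<bar>arctan x + x / (1 + x\<^sup>2)\<bar> \<le> pi / 2"
proof -
  \<comment> \<open>With \<open>x = tan u\<close> the left-hand side is \<open>u + sin (2 u) / 2\<close>.\<close>
  have le: "arctan x + x / (1 + x\<^sup>2) \<le> pi / 2" for x :: real
  proof -
    define u where "u = arctan x"
    have u: "- (pi/2) < u" "u < pi/2" using arctan_bounded by (auto simp: u_def)
    have c: "cos u > 0" using u by (simp add: cos_gt_zero_pi)
    have "tan u = x" by (simp add: u_def tan_arctan)
    then have sin: "sin u = x * cos u" using c by (auto simp: tan_def)
    have "(cos u)\<^sup>2 * (1 + x\<^sup>2) = 1"
      using sin_cos_squared_add[of u] unfolding sin by (simp add: power_mult_distrib algebra_simps)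
    moreover have "1 + x\<^sup>2 \<noteq> 0" by (smt (verit) zero_le_power2)
    ultimately have "x / (1 + x\<^sup>2) = x * (cos u)\<^sup>2"
      by (simp add: divide_eq_eq)
    then have "x / (1 + x\<^sup>2) = sin u * cos u"
      by (simp add: sin power2_eq_square)
    \<comment> \<open>Reflection reduces the claim to sin y \<le> y for y = pi - 2 u \<ge> 0, and y
      / 2 is exactly the distance of u from pi / 2.\<close>
    also have "\<dots> = sin (pi - 2 * u) / 2" by (simp add: sin_double)
    also have "\<dots> \<le> (pi - 2 * u) / 2" using sin_x_le_x[of "pi - 2 * u"] u by simp
    finally show ?thesis by (simp add: u_def field_simps)
  qed
  have "- (arctan x + x / (1 + x\<^sup>2)) \<le> pi / 2" using le[of "-x"] by (simp add: arctan_minus)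
  with le[of x] show ?thesis unfolding abs_le_iff by blast
qed

text \<open>The value is 1/e at speed \<open>s\<close>; this is the property for which \<gamma> is
  chosen.\<close>

lemma gamma_fun_derivative:
  assumes "n > 0"
  shows "(gamma_fun n has_real_derivative 2 / (s\<^sup>2 + real n)) (at s)"
proof -
  have "((\<lambda>s. 2 / sqrt n * arctan (s / sqrt n)) has_real_derivative
     2 / sqrt n * (inverse (1 + (s / sqrt n)\<^sup>2) * (1 / sqrt n))) (at s)"
    by (rule DERIV_cmult[OF DERIV_chain2[OF DERIV_arctan DERIV_cdivide[OF DERIV_ident]]])
  moreover have "2 / sqrt n * (inverse (1 + (s / sqrt n)\<^sup>2) * (1 / sqrt n)) = 2 / (s\<^sup>2 + real n)"
  proof -
    have "1 + (s / sqrt n)\<^sup>2 = (s\<^sup>2 + real n) / real n"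
      using assms by (simp add: power_divide add_divide_distrib)
    then have "inverse (1 + (s / sqrt n)\<^sup>2) = real n / (s\<^sup>2 + real n)" by simp
    moreover have "2 / sqrt n * (k * (1 / sqrt n)) = 2 * k / real n" for k
      by simp
    ultimately have "2 / sqrt n * (inverse (1 + (s / sqrt n)\<^sup>2) * (1 / sqrt n)) = 2 * (real n / (s\<^sup>2 + real n)) / real n"
      by (simp only:)
    then show ?thesis using assms by simp
  qed
  ultimately show ?thesis by (simp add: gamma_fun_def[abs_def])
qed

lemma gamma_fun_bound: "\<bar>gamma_fun n s\<bar> \<le> pi / sqrt (real n)"
proof -
  have "\<bar>arctan (s / sqrt n)\<bar> \<le> pi / 2"
    using arctan_bounded[of "s / sqrt n"] by linarith
  then have "2 / sqrt n * \<bar>arctan (s / sqrt n)\<bar> \<le> 2 / sqrt n * (pi / 2)"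
    by (intro mult_left_mono) auto
  then show ?thesis by (simp add: gamma_fun_def abs_mult)
qed

text \<open>
  This is \<open>\<sigma>/e + \<gamma>\<close> as a function of \<open>\<sigma>\<close>, the density of \<open>f\<^sub>U\<close> with respect to \<open>e d\<mu>\<close>.
\<close>

definition flux :: "nat \<Rightarrow> real \<Rightarrow> real" where
  "flux n s = 2 * s / (s\<^sup>2 + real n) + gamma_fun n s"

text \<open>In terms of e = (s^2 + n) / 2 the value is n / e^2. The factor e H from the chain rule
  then leaves n H / e, which is n times the density of H d\<mu> with respect to e d\<mu>.\<close>

lemma flux_derivative:
  assumes "n > 0"
  shows "(flux n has_real_derivative 4 * real n / (s\<^sup>2 + real n)\<^sup>2) (at s)"
proof -
  have pos: "s\<^sup>2 + real n \<noteq> 0" using assms by (smt (verit) of_nat_0_less_iff zero_le_power2)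
  have "((\<lambda>s. 2 * s / (s\<^sup>2 + real n) + gamma_fun n s) has_real_derivative
     (2 * (s\<^sup>2 + real n) - 2 * s * (2 * s)) / (s\<^sup>2 + real n)\<^sup>2 + 2 / (s\<^sup>2 + real n)) (at s)"
    using pos by (auto intro!: derivative_eq_intros gamma_fun_derivative assms simp: power2_eq_square)
  moreover have "(2 * (s\<^sup>2 + real n) - 2 * s * (2 * s)) / (s\<^sup>2 + real n)\<^sup>2 + 2 / (s\<^sup>2 + real n) =
     4 * real n / (s\<^sup>2 + real n)\<^sup>2"
    using pos by (simp add: divide_simps) (simp add: power2_eq_square algebra_simps)
  ultimately show ?thesis by (simp add: flux_def[abs_def])
qed

lemma flux_bound:
  assumes "n > 0"
  shows "\<bar>flux n s\<bar> \<le> pi / sqrt (real n)"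
proof -
  \<comment> \<open>Scaling by sqrt n turns the flux into 2 / sqrt n times the function estimated in
    \<open>arctan_plus_le\<close>.\<close>
  define x where "x = s / sqrt n"
  have s: "s = sqrt n * x" using assms by (simp add: x_def)
  have "2 * s / (s\<^sup>2 + real n) = 2 / sqrt n * (x / (1 + x\<^sup>2))"
  proof -
    have "1 + x\<^sup>2 > 0" by (smt (verit) zero_le_power2)
    moreover have "s\<^sup>2 + real n = sqrt n * sqrt n * (1 + x\<^sup>2)"
      by (simp add: s power_mult_distrib algebra_simps)
    ultimately show ?thesis using assms by (simp add: s del: real_sqrt_mult_self)
  qed
  then have "flux n s = 2 / sqrt n * (arctan x + x / (1 + x\<^sup>2))"
    by (simp add: flux_def gamma_fun_def x_def algebra_simps)
  then have "\<bar>flux n s\<bar> = 2 / sqrt n * \<bar>arctan x + x / (1 + x\<^sup>2)\<bar>"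
    by (simp only: abs_mult) simp
  also have "\<dots> \<le> 2 / sqrt n * (pi / 2)"
    by (intro mult_left_mono arctan_plus_le) auto
  finally show ?thesis by simp
qed

text \<open>A convergent sequence of times is bounded, so a bound that is uniform only up to each
  time \<open>K\<close> suffices for dominated convergence; constants are integrable because the
  measure is finite.\<close>

lemma continuous_on_integral_dominated:
  fixes h :: "real \<Rightarrow> 'a \<Rightarrow> real"
  assumes M: "finite_measure M"
    and meas: "\<And>t. t \<in> S \<Longrightarrow> h t \<in> borel_measurable M"
    and cont: "\<And>p. p \<in> space M \<Longrightarrow> continuous_on S (\<lambda>t. h t p)"
    and bound: "\<And>K. \<exists>B. \<forall>t\<in>S. \<forall>p\<in>space M. t \<le> K \<longrightarrow> \<bar>h t p\<bar> \<le> B"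
  shows "continuous_on S (\<lambda>t. LINT p|M. h t p)"
  unfolding continuous_on_sequentially comp_def
proof (intro allI ballI impI)
  interpret finite_measure M by fact
  fix x t assume t: "t \<in> S" and x: "(\<forall>k. x k \<in> S) \<and> x \<longlonglongrightarrow> t"
  then obtain K where K: "\<And>k. \<bar>x k\<bar> \<le> K"
    using convergent_imp_Bseq[of x] by (auto simp: convergent_def Bseq_def)
  obtain B where B: "\<And>t p. t \<in> S \<Longrightarrow> p \<in> space M \<Longrightarrow> t \<le> K \<Longrightarrow> \<bar>h t p\<bar> \<le> B"
    using bound[of K] by auto
  show "(\<lambda>k. LINT p|M. h (x k) p) \<longlonglongrightarrow> (LINT p|M. h t p)"
  proof (rule integral_dominated_convergence[where w="\<lambda>_. B"])
    show "AE p in M. (\<lambda>k. h (x k) p) \<longlonglongrightarrow> h t p"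
      using cont t x by (auto simp: continuous_on_sequentially comp_def)
    show "AE p in M. norm (h (x k) p) \<le> B" for k
      using B x K by (auto simp: abs_le_iff)
  qed (use meas t x in auto)
qed

section \<open>The volume measure in coordinates\<close>

lemma
  assumes A: "smooth_atlas A" and \<mu>: "is_volume_measure A f \<mu>"
  shows open_in_volume_measure: "open W \<Longrightarrow> W \<in> sets \<mu>" and space_volume_measure: "space \<mu> = UNIV"
proof -
  show op: "W \<in> sets \<mu>" if W: "open W" for W
  proof -
    have "open (snd c ` (W \<inter> fst c))" if "c \<in> A" for c
    proof -
      have "is_chart c" using A that by (auto simp: smooth_atlas_def)
      note C = is_chartD[OF this]
      have "snd c ` (W \<inter> fst c) = snd c ` fst c \<inter> chart_inv c -` W"
        using C(5) by auto
      then show ?thesis using continuous_open_preimage[OF C(4) C(2) W] by simp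
    qed
    then show ?thesis using \<mu> by (auto simp: is_volume_measure_def)
  qed
  show "space \<mu> = UNIV" using op[OF open_UNIV] sets.sets_into_space by blast
qed

text \<open>The definition of the volume measure speaks only about measures of sets. It says that
  \<mu> restricted to the chart domain is the image under \<open>chart_inv c\<close> of sqrt(det g)
  dx, and an equality of measures carries over to integrals. Continuity of the determinant makes the
  density measurable.\<close>

lemma nn_integral_volume_measure_chart:
  assumes A: "smooth_atlas A" and \<mu>: "is_volume_measure A f \<mu>" and c: "c \<in> A"
    and det: "continuous_on (snd c ` fst c) (\<lambda>y. det (metric c f (chart_inv c y)))"
    and g: "g \<in> borel_measurable \<mu>" "\<And>p. p \<notin> fst c \<Longrightarrow> g p = 0"
  shows "(\<integral>\<^sup>+p. g p \<partial>\<mu>) =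
     (\<integral>\<^sup>+y. g (chart_inv c y) * ennreal (sqrt (det (metric c f (chart_inv c y))))
        \<partial>restrict_space lebesgue (snd c ` fst c))"
proof -
  have "is_chart c" using A c by (auto simp: smooth_atlas_def)
  note C = is_chartD[OF this]
  let ?V = "snd c ` fst c" and ?d = "\<lambda>y. ennreal (sqrt (det (metric c f (chart_inv c y))))"
  let ?L = "restrict_space lebesgue ?V"
  have V: "?V \<in> sets lebesgue" using C(2) by auto
  have spL: "space ?L = ?V" by (simp add: space_restrict_space)
  have dm[measurable]: "?d \<in> borel_measurable ?L"
  proof -
    have "(\<lambda>y. det (metric c f (chart_inv c y))) \<in> borel_measurable (restrict_space borel ?V)"
      by (rule borel_measurable_continuous_on_restrict[OF det])
    then have "(\<lambda>y. indicator ?V y *\<^sub>R det (metric c f (chart_inv c y))) \<in> borel_measurable borel"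
      by (subst (asm) borel_measurable_restrict_space_iff) (use C(2) in auto)
    then have "(\<lambda>y. indicator ?V y *\<^sub>R det (metric c f (chart_inv c y))) \<in> borel_measurable lebesgue"
      by (intro measurable_completion) simp
    then have "(\<lambda>y. det (metric c f (chart_inv c y))) \<in> borel_measurable ?L"
      by (subst borel_measurable_restrict_space_iff) (use V in auto)
    then show ?thesis by measurable
  qed
  have pre: "chart_inv c -` B \<inter> ?V = snd c ` (B \<inter> fst c)" for B
    using C(5) by auto
  have inv[measurable]: "chart_inv c \<in> ?L \<rightarrow>\<^sub>M \<mu>"
  proof (rule measurableI)
    fix B assume "B \<in> sets \<mu>"
    then have "snd c ` (B \<inter> fst c) \<in> sets lebesgue"
      using \<mu> c by (auto simp: is_volume_measure_def)
    then show "chart_inv c -` B \<inter> space ?L \<in> sets ?L"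
      unfolding spL pre using V by (subst sets_restrict_space_iff) auto
  qed (simp add: space_volume_measure[OF A \<mu>])
  have fc: "fst c \<in> sets \<mu>" by (rule open_in_volume_measure[OF A \<mu> C(1)])
  have eq: "density \<mu> (indicator (fst c)) = distr (density ?L ?d) \<mu> (chart_inv c)"
  proof (rule measure_eqI)
    fix B assume "B \<in> sets (density \<mu> (indicator (fst c)))"
    then have B: "B \<in> sets \<mu>" by simp
    have Bc: "B \<inter> fst c \<in> sets \<mu>" using B fc by auto
    have "emeasure (density \<mu> (indicator (fst c))) B = (\<integral>\<^sup>+p. indicator (fst c) p * indicator B p \<partial>\<mu>)"
      using B fc by (intro emeasure_density) auto
    also have "\<dots> = (\<integral>\<^sup>+p. indicator (B \<inter> fst c) p \<partial>\<mu>)"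
      by (rule nn_integral_cong) (auto simp: indicator_def)
    also have "\<dots> = emeasure \<mu> (B \<inter> fst c)" by (rule nn_integral_indicator[OF Bc])
    also have "\<dots> = (\<integral>\<^sup>+y\<in>snd c ` (B \<inter> fst c). ?d y \<partial>lebesgue)"
      using \<mu> c Bc unfolding is_volume_measure_def by (meson inf_le2)
    also have "\<dots> = (\<integral>\<^sup>+y. ?d y * indicator (snd c ` (B \<inter> fst c)) y \<partial>?L)"
      using V by (subst nn_integral_restrict_space)
        (simp, rule nn_integral_cong, auto simp: indicator_def)
    also have "\<dots> = emeasure (density ?L ?d) (snd c ` (B \<inter> fst c))"
      using measurable_sets[OF inv B] unfolding spL pre by (subst emeasure_density) auto
    also have "\<dots> = emeasure (distr (density ?L ?d) \<mu> (chart_inv c)) B"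
      using B by (subst emeasure_distr) (auto simp: spL pre)
    finally show "emeasure (density \<mu> (indicator (fst c))) B = emeasure (distr (density ?L ?d) \<mu> (chart_inv c)) B" .
  qed simp
  have "(\<integral>\<^sup>+p. g p \<partial>\<mu>) = (\<integral>\<^sup>+p. g p \<partial>density \<mu> (indicator (fst c)))"
    using g fc by (subst nn_integral_density)
      (simp_all, rule nn_integral_cong, auto simp: indicator_def)
  also have "\<dots> = (\<integral>\<^sup>+y. g (chart_inv c y) \<partial>density ?L ?d)"
    unfolding eq using g by (subst nn_integral_distr) auto
  also have "\<dots> = (\<integral>\<^sup>+y. ?d y * g (chart_inv c y) \<partial>?L)"
    using measurable_compose[OF inv g(1)] by (subst nn_integral_density) auto
  finally show ?thesis by (simp add: mult.commute)
qed

subsection \<open>The conserved energy measure\<close>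

context hmcf
begin

lemma energy_ge: "t \<in> I \<Longrightarrow> e t p \<ge> real CARD('n) / 2"
  and energy_pos: "t \<in> I \<Longrightarrow> e t p > 0"
proof -
  assume t: "t \<in> I"
  show ge: "e t p \<ge> real CARD('n) / 2" by (simp add: energy_speed[OF t])
  then show "e t p > 0" by (smt (verit) divide_pos_pos of_nat_0_less_iff zero_less_card_finite)
qed

lemma energy_volume_sqrt:
  assumes "d \<in> A" "p \<in> fst d" "t \<in> I"
  shows "e t p * sqrt (det (metric d (F t) p)) = e 0 p * sqrt (det (metric d (F 0) p))"
proof -
  have "sqrt ((e t p)\<^sup>2 * det (metric d (F t) p)) = sqrt ((e 0 p)\<^sup>2 * det (metric d (F 0) p))"
    using energy_volume_constant[OF assms] by simp
  then show ?thesis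
    using energy_pos[OF assms(3), of p] energy_pos[OF zero_I, of p] by (simp add: real_sqrt_mult)
qed

lemma energy_continuous: "b \<in> I \<Longrightarrow> continuous_on {0..b} (\<lambda>t. e t p)"
  unfolding continuous_on_eq_continuous_within by (blast intro: DERIV_continuous energy_derivative)

lemma mean_curvature_eq: "t \<in> I \<Longrightarrow> H t p = (dt T (dt T F) t p \<bullet> \<nu> t p) / e t p"
  using acceleration_normal[of t p] energy_pos[of t p] by simp

lemma mean_curvature_continuous:
  assumes b: "b \<in> I"
  shows "continuous_on {0..b} (\<lambda>t. H t p)"
proof -
  have I: "{0..b} \<subseteq> I" by (rule time_dom_Icc[OF b])
  have "continuous_on {0..b} ((\<lambda>(t, p). dt T (dt T F) t p \<bullet> \<nu> t p) \<circ> (\<lambda>t. (t, p)))"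
    by (rule continuous_on_compose)
       (use I in \<open>auto intro!: continuous_intros continuous_on_subset[OF continuous_acceleration]\<close>)
  then have "continuous_on {0..b} (\<lambda>t. (dt T (dt T F) t p \<bullet> \<nu> t p) / e t p)"
    unfolding o_def prod.case
    by (intro continuous_on_divide energy_continuous[OF b])
       (use I energy_pos in \<open>auto simp: subset_iff less_imp_neq[symmetric]\<close>)
  then show ?thesis
    by (rule continuous_on_cong[THEN iffD1, rotated 2]) (use I mean_curvature_eq in auto)
qed

lemma flux_speed_derivative:
  assumes b: "b \<in> I" and t: "t \<in> {0..b}"
  shows "((\<lambda>s. flux CARD('n) (\<sigma> s p) / real CARD('n)) has_real_derivative H t p / e t p) (at t within {0..b})"
proof -
  have tI: "t \<in> I" using time_dom_Icc[OF b] t by auto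
  have n: "CARD('n) > 0" by simp
  have "((\<lambda>s. flux CARD('n) (\<sigma> s p) / real CARD('n)) has_real_derivative
     (4 * real CARD('n) / ((\<sigma> t p)\<^sup>2 + real CARD('n))\<^sup>2 * (e t p * H t p)) / real CARD('n)) (at t within {0..b})"
    by (rule DERIV_cdivide[OF DERIV_chain2[OF flux_derivative[OF n] speed_derivative[OF b t]]])
  moreover have "(\<sigma> t p)\<^sup>2 + real CARD('n) = 2 * e t p" by (simp add: energy_speed[OF tI])
  then have "(4 * real CARD('n) / ((\<sigma> t p)\<^sup>2 + real CARD('n))\<^sup>2 * (e t p * H t p)) / real CARD('n) = H t p / e t p"
    using energy_pos[OF tI, of p] by (simp add: power2_eq_square)
  ultimately show ?thesis by simp
qed

lemma gamma_speed_derivative: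
  assumes b: "b \<in> I" and t: "t \<in> {0..b}"
  shows "((\<lambda>s. gamma_fun CARD('n) (\<sigma> s p)) has_real_derivative H t p) (at t within {0..b})"
proof -
  have tI: "t \<in> I" using time_dom_Icc[OF b] t by auto
  have n: "CARD('n) > 0" by simp
  have "((\<lambda>s. gamma_fun CARD('n) (\<sigma> s p)) has_real_derivative
     2 / ((\<sigma> t p)\<^sup>2 + real CARD('n)) * (e t p * H t p)) (at t within {0..b})"
    by (rule DERIV_chain2[OF gamma_fun_derivative[OF n] speed_derivative[OF b t]])
  moreover have "(\<sigma> t p)\<^sup>2 + real CARD('n) = 2 * e t p" by (simp add: energy_speed[OF tI])
  then have "2 / ((\<sigma> t p)\<^sup>2 + real CARD('n)) * (e t p * H t p) = H t p"
    using energy_pos[OF tI, of p] by simp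
  ultimately show ?thesis by simp
qed

lemma f_integrand_flux:
  assumes t: "t \<in> I"
  shows "f_integrand A T F \<nu> t p = flux CARD('n) (\<sigma> t p) * e t p"
proof -
  have "(\<sigma> t p)\<^sup>2 + real CARD('n) = 2 * e t p" by (simp add: energy_speed[OF t])
  then show ?thesis
    using energy_pos[OF t, of p] by (simp add: f_integrand_def flux_def distrib_right)
qed

end

locale hmcf_volume = hmcf A T F \<nu>
  for A :: "('m::{t2_space, second_countable_topology}, 'n::finite) chart set"
    and T :: ereal
    and F \<nu> :: "real \<Rightarrow> 'm \<Rightarrow> real ^ 'k::finite" +
  fixes \<mu> :: "real \<Rightarrow> 'm measure" and U :: "'m set"
  assumes vol: "t \<in> time_dom T \<Longrightarrow> is_volume_measure A (F t) (\<mu> t)"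
    and integrable: "integrable_set A T F \<nu> \<mu> U"
begin

text \<open>The restriction to \<open>U\<close> is part of the density. The measure is therefore
  finite, with total mass E_U, and still lives on the whole manifold.\<close>

definition energy_measure :: "real \<Rightarrow> 'm measure" where
  "energy_measure t = density (\<mu> t) (\<lambda>p. ennreal (indicator U p * e t p))"

lemma energy_measurable: "t \<in> I \<Longrightarrow> (\<lambda>p. indicator U p * e t p) \<in> borel_measurable (\<mu> t)"
  using integrable by (auto simp: integrable_set_def set_integrable_def)

lemma sets_mu: "t \<in> I \<Longrightarrow> sets (\<mu> t) = sets (\<mu> 0)"
  using vol zero_I by (simp add: is_volume_measure_def)

text \<open>In the coordinates of \<open>c\<close> both sides are integrals of e sqrt(det g) over
  the same set, and this density is the same function at all times.\<close>

lemma energy_measure_chart: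
  assumes t: "t \<in> I" and c: "c \<in> A" and B: "B \<in> sets (\<mu> 0)" "B \<subseteq> fst c"
  shows "emeasure (energy_measure t) B = emeasure (energy_measure 0) B"
proof -
  obtain DF DN DDF DDN where "hmcf_chart A T F \<nu> c DF DN DDF DDN" using chart_jets[OF c] .
  then interpret hmcf_chart A T F \<nu> c DF DN DDF DDN .
  have "emeasure (energy_measure s) B =
     (\<integral>\<^sup>+y. indicator B (point y) * indicator U (point y) *
        ennreal (e 0 (point y) * sqrt (det (metric c (F 0) (point y)))) \<partial>restrict_space lebesgue V)"
    if s: "s \<in> I" for s
  proof -
    let ?g = "\<lambda>p. ennreal (indicator U p * e s p) * indicator B p"
    have Bs: "B \<in> sets (\<mu> s)" using B sets_mu[OF s] by simp
    have m: "(\<lambda>p. ennreal (indicator U p * e s p)) \<in> borel_measurable (\<mu> s)"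
      using energy_measurable[OF s] by measurable
    have "emeasure (energy_measure s) B = (\<integral>\<^sup>+p. ?g p \<partial>\<mu> s)"
      unfolding energy_measure_def by (rule emeasure_density[OF m Bs])
    also have "\<dots> = (\<integral>\<^sup>+y. ?g (point y) * ennreal (sqrt (det (metric c (F s) (point y)))) \<partial>restrict_space lebesgue V)"
      by (rule nn_integral_volume_measure_chart[OF atlas vol[OF s] c continuous_det_metric[OF s]])
         (use m Bs B in \<open>auto simp: indicator_def\<close>)
    also have "\<dots> = (\<integral>\<^sup>+y. indicator B (point y) * indicator U (point y) *
        ennreal (e 0 (point y) * sqrt (det (metric c (F 0) (point y)))) \<partial>restrict_space lebesgue V)"
    proof (rule nn_integral_cong)
      fix y assume "y \<in> space (restrict_space lebesgue V)"
      then have y: "point y \<in> fst c" using chart(7) by (simp add: space_restrict_space)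
      have "ennreal (e s (point y)) * ennreal (sqrt (det (metric c (F s) (point y)))) =
          ennreal (e 0 (point y) * sqrt (det (metric c (F 0) (point y))))"
        using energy_pos[OF s, of "point y"] energy_volume_sqrt[OF c y s]
        by (simp add: ennreal_mult'[symmetric])
      then show "?g (point y) * ennreal (sqrt (det (metric c (F s) (point y)))) =
          indicator B (point y) * indicator U (point y) *
          ennreal (e 0 (point y) * sqrt (det (metric c (F 0) (point y))))"
        by (simp add: indicator_def)
    qed
    finally show ?thesis .
  qed
  from this[OF t] this[OF zero_I] show ?thesis by simp
qed

text \<open>By second countability, countably many chart domains cover the manifold. A measurable
  set is cut into disjoint pieces that each lie in one chart, and countable additivity assembles the
  local equalities.\<close>

lemma energy_measure_constant:
  assumes t: "t \<in> I"
  shows "energy_measure t = energy_measure 0"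
proof (rule measure_eqI)
  show "sets (energy_measure t) = sets (energy_measure 0)"
    by (simp add: energy_measure_def sets_mu[OF t])
  fix B assume "B \<in> sets (energy_measure t)"
  then have B: "B \<in> sets (\<mu> 0)" by (simp add: energy_measure_def sets_mu[OF t])
  obtain \<C> where \<C>: "\<C> \<subseteq> fst ` A" "countable \<C>" "\<Union>\<C> = \<Union>(fst ` A)"
    by (rule Lindelof[of "fst ` A"]) (use is_chart is_chartD(1) in blast)
  have un: "\<Union>\<C> = UNIV" using \<C>(3) atlas by (simp add: smooth_atlas_def)
  then have ne: "\<C> \<noteq> {}" by auto
  \<comment> \<open>This enumerates the nonempty countable cover, with repetitions if it is finite;
    \<open>disjointed\<close> removes the overlaps.\<close>
  define W where "W = (\<lambda>i. from_nat_into \<C> i)"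
  have rW: "range W = \<C>" unfolding W_def by (rule range_from_nat_into[OF ne \<C>(2)])
  have W: "W i \<in> sets (\<mu> 0)" "\<exists>c\<in>A. W i \<subseteq> fst c" for i
  proof -
    have "W i \<in> fst ` A" using rW \<C>(1) by auto
    then obtain c where c: "c \<in> A" "W i = fst c" by auto
    then show "W i \<in> sets (\<mu> 0)" "\<exists>c\<in>A. W i \<subseteq> fst c"
      using open_in_volume_measure[OF atlas vol[OF zero_I] is_chartD(1)[OF is_chart[OF c(1)]]] by auto
  qed
  define D where "D = (\<lambda>i. B \<inter> disjointed W i)"
  have D: "D i \<in> sets (\<mu> 0)" for i
    using B sets.range_disjointed_sets[of W "\<mu> 0"] W(1) by (auto simp: D_def)
  have dD: "disjoint_family D"
    using disjoint_family_disjointed[of W] by (auto simp: D_def disjoint_family_on_def)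
  have uD: "(\<Union>i. D i) = B"
    using UN_disjointed_eq[of W] rW un by (simp add: D_def Int_UN_distrib[symmetric])
  have eq: "emeasure (energy_measure t) (D i) = emeasure (energy_measure 0) (D i)" for i
  proof -
    obtain c where c: "c \<in> A" "W i \<subseteq> fst c" using W(2) by blast
    have "D i \<subseteq> fst c" using disjointed_subset[of W i] c(2) by (auto simp: D_def)
    then show ?thesis by (rule energy_measure_chart[OF t c(1) D])
  qed
  have sum: "(\<Sum>i. emeasure (energy_measure s) (D i)) = emeasure (energy_measure s) B" if "s \<in> I" for s
    using suminf_emeasure[of D "energy_measure s"] D dD uD sets_mu[OF that]
    by (auto simp: energy_measure_def)
  show "emeasure (energy_measure t) B = emeasure (energy_measure 0) B"
    unfolding sum[OF t, symmetric] sum[OF zero_I, symmetric] eq ..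
qed

abbreviation "m \<equiv> energy_measure 0"

text \<open>Since d\<mu> = (1/e) dm on \<open>U\<close>, an integrand \<open>X\<close> against the
  moving measure becomes \<open>X p / e t p\<close> against the fixed measure \<open>m\<close>. Only
  after this translation do integrals at different times live on one measure space, as Fubini and
  dominated convergence require.\<close>

lemma
  assumes t: "t \<in> I" and X: "set_integrable (\<mu> t) U X"
  shows measurable_energy_measure: "(\<lambda>p. indicator U p * (X p / e t p)) \<in> borel_measurable m"
    and integrable_energy_measure: "integrable m (\<lambda>p. indicator U p * (X p / e t p))"
    and integral_energy_measure: "(LINT p:U|\<mu> t. X p) = (LINT p|m. indicator U p * (X p / e t p))"
    and nn_integral_energy_measure:
      "(\<integral>\<^sup>+p\<in>U. ennreal \<bar>X p\<bar> \<partial>\<mu> t) = (\<integral>\<^sup>+p. ennreal \<bar>indicator U p * (X p / e t p)\<bar> \<partial>m)"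
proof -
  let ?Y = "\<lambda>p. indicator U p * (X p / e t p)" and ?d = "\<lambda>p. indicator U p * e t p"
  have m: "m = density (\<mu> t) (\<lambda>p. ennreal (?d p))"
    using energy_measure_constant[OF t] by (simp add: energy_measure_def)
  have d[measurable]: "?d \<in> borel_measurable (\<mu> t)" by (rule energy_measurable[OF t])
  have pos: "e t p > 0" for p by (rule energy_pos[OF t])
  have Xi: "integrable (\<mu> t) (\<lambda>p. indicator U p * X p)"
    using X by (simp add: set_integrable_def)
  have "(\<lambda>p. (indicator U p * X p) / ?d p) \<in> borel_measurable (\<mu> t)"
    using borel_measurable_divide[OF borel_measurable_integrable[OF Xi] d] .
  \<comment> \<open>Outside \<open>U\<close> the quotient is 0 / 0, which is 0 and thus agrees with
    the right-hand side.\<close>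
  also have "(\<lambda>p. (indicator U p * X p) / ?d p) = ?Y" by (auto simp: indicator_def)
  finally have Y[measurable]: "?Y \<in> borel_measurable (\<mu> t)" .
  then show "?Y \<in> borel_measurable m" by (simp add: m)
  have dY: "(\<lambda>p. ?d p * ?Y p) = (\<lambda>p. indicator U p * X p)"
    using less_imp_neq[OF pos, THEN not_sym] by (auto simp: indicator_def fun_eq_iff)
  have nn: "AE p in \<mu> t. 0 \<le> ?d p" using pos by (auto simp: indicator_def less_imp_le)
  show "integrable m ?Y"
    unfolding m using integrable_real_density[OF d nn Y] Xi dY by simp
  show "(LINT p:U|\<mu> t. X p) = (LINT p|m. ?Y p)"
    unfolding m using integral_real_density[OF d nn Y] dY by (simp add: set_lebesgue_integral_def)
  have "(\<integral>\<^sup>+p. ennreal \<bar>?Y p\<bar> \<partial>m) = (\<integral>\<^sup>+p. ennreal (?d p) * ennreal \<bar>?Y p\<bar> \<partial>\<mu> t)"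
    unfolding m by (rule nn_integral_density) measurable
  also have "\<dots> = (\<integral>\<^sup>+p\<in>U. ennreal \<bar>X p\<bar> \<partial>\<mu> t)"
  proof (rule nn_integral_cong)
    fix p
    have "e t p * \<bar>X p / e t p\<bar> = \<bar>X p\<bar>" using pos[of p] by (simp add: abs_divide)
    then have "ennreal (e t p) * ennreal \<bar>X p / e t p\<bar> = ennreal \<bar>X p\<bar>"
      using pos[of p] by (simp add: ennreal_mult'[symmetric])
    then show "ennreal (?d p) * ennreal \<bar>?Y p\<bar> = ennreal \<bar>X p\<bar> * indicator U p"
      by (simp add: indicator_def)
  qed
  finally show "(\<integral>\<^sup>+p\<in>U. ennreal \<bar>X p\<bar> \<partial>\<mu> t) = (\<integral>\<^sup>+p. ennreal \<bar>?Y p\<bar> \<partial>m)" by simp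
qed

lemma integrableD:
  assumes "t \<in> I"
  shows "set_integrable (\<mu> t) U (e t)" "set_integrable (\<mu> t) U (\<sigma> t)"
    "set_integrable (\<mu> t) U (f_integrand A T F \<nu> t)" "set_integrable (\<mu> t) U (H t)"
    "set_integrable (\<mu> t) U (\<lambda>p. H t p * e t p)"
  using integrable assms by (auto simp: integrable_set_def)

lemma finite_energy_measure: "finite_measure m"
proof
  have "integrable (\<mu> 0) (\<lambda>p. indicator U p * e 0 p)"
    using integrableD(1)[OF zero_I] by (simp add: set_integrable_def)
  then have "(\<integral>\<^sup>+p. ennreal (norm (indicator U p * e 0 p)) \<partial>\<mu> 0) < \<infinity>"
    by (simp add: integrable_iff_bounded)
  also have "(\<integral>\<^sup>+p. ennreal (norm (indicator U p * e 0 p)) \<partial>\<mu> 0) = emeasure m (space m)"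
    using energy_measurable[OF zero_I] energy_pos[OF zero_I] unfolding energy_measure_def
    by (subst emeasure_density) (auto intro!: nn_integral_cong simp: indicator_def less_imp_le)
  finally show "emeasure m (space m) \<noteq> \<infinity>" by simp
qed

lemma U_sets: "U \<in> sets m"
  using integrable zero_I by (auto simp: energy_measure_def integrable_set_def)

text \<open>The quotient of the integrand by e is 1. As \<open>s\<close> is absent from the
  right-hand side, this is the independence of E_U of time.\<close>

lemma E_U_eq: "s \<in> I \<Longrightarrow> E_U A T F \<mu> U s = (LINT p|m. indicator U p)"
  unfolding E_U_def
  by (subst integral_energy_measure[OF _ integrableD(1)])
     (use energy_pos in \<open>auto intro!: Bochner_Integration.integral_cong simp: less_imp_neq[symmetric]\<close>)

lemma indicator_integral_bound:
  assumes X: "integrable m (\<lambda>p. indicator U p * X p)" and k: "\<And>p. \<bar>X p\<bar> \<le> k" and s: "s \<in> I"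
  shows "\<bar>LINT p|m. indicator U p * X p\<bar> \<le> k * E_U A T F \<mu> U s"
proof -
  interpret finite_measure m by (rule finite_energy_measure)
  have i: "integrable m (\<lambda>p. k * indicator U p)"
    using U_sets by (intro integrable_mult_right integrable_real_indicator) (auto simp: less_top[symmetric])
  have "\<bar>LINT p|m. indicator U p * X p\<bar> \<le> (LINT p|m. \<bar>indicator U p * X p\<bar>)"
    using integral_abs_bound .
  also have "\<dots> \<le> (LINT p|m. k * indicator U p)"
    by (rule integral_mono[OF integrable_abs[OF X] i]) (use k in \<open>auto simp: indicator_def\<close>)
  finally show ?thesis by (simp add: E_U_eq[OF s])
qed

end

subsection \<open>Integral identities and bounds\<close>

context hmcf_volume
begin

lemma
  assumes t: "t \<in> I"
  shows integrable_flux: "integrable m (\<lambda>p. indicator U p * flux CARD('n) (\<sigma> t p))"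
    and f_U_flux: "f_U A T F \<nu> \<mu> U t = (LINT p|m. indicator U p * flux CARD('n) (\<sigma> t p))"
proof -
  have "f_integrand A T F \<nu> t p / e t p = flux CARD('n) (\<sigma> t p)" for p
    using energy_pos[OF t, of p] by (simp add: f_integrand_flux[OF t])
  then show "integrable m (\<lambda>p. indicator U p * flux CARD('n) (\<sigma> t p))"
    and "f_U A T F \<nu> \<mu> U t = (LINT p|m. indicator U p * flux CARD('n) (\<sigma> t p))"
    using integrable_energy_measure[OF t integrableD(3)[OF t]] integral_energy_measure[OF t integrableD(3)[OF t]]
    by (simp_all add: f_U_def)
qed

lemma
  assumes t: "t \<in> I"
  shows integrable_gamma: "integrable m (\<lambda>p. indicator U p * gamma_fun CARD('n) (\<sigma> t p))"
    and f_U_minus_speed: "f_U A T F \<nu> \<mu> U t - (LINT p:U|\<mu> t. \<sigma> t p) =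
      (LINT p|m. indicator U p * gamma_fun CARD('n) (\<sigma> t p))"
proof -
  have eq: "indicator U p * gamma_fun CARD('n) (\<sigma> t p) =
      indicator U p * flux CARD('n) (\<sigma> t p) - indicator U p * (\<sigma> t p / e t p)" for p
  proof -
    have "(\<sigma> t p)\<^sup>2 + real CARD('n) = 2 * e t p" by (simp add: energy_speed[OF t])
    then show ?thesis by (simp add: flux_def algebra_simps)
  qed
  note s = integrable_energy_measure[OF t integrableD(2)[OF t]]
  show "integrable m (\<lambda>p. indicator U p * gamma_fun CARD('n) (\<sigma> t p))"
    unfolding eq by (intro Bochner_Integration.integrable_diff integrable_flux t s)
  show "f_U A T F \<nu> \<mu> U t - (LINT p:U|\<mu> t. \<sigma> t p) =
      (LINT p|m. indicator U p * gamma_fun CARD('n) (\<sigma> t p))"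
    unfolding eq f_U_flux[OF t] integral_energy_measure[OF t integrableD(2)[OF t]]
    by (rule Bochner_Integration.integral_diff[symmetric]) (intro integrable_flux t s)+
qed

lemma int_H_eq: "t \<in> I \<Longrightarrow> int_H A F \<nu> \<mu> U t = (LINT p|m. indicator U p * (H t p / e t p))"
  unfolding int_H_def by (rule integral_energy_measure[OF _ integrableD(4)])

lemma mean_curvature_cancel: "t \<in> I \<Longrightarrow> H t p * e t p / e t p = H t p"
  using energy_pos[of t p] by simp

lemma int_He_eq: "t \<in> I \<Longrightarrow> int_He A T F \<nu> \<mu> U t = (LINT p|m. indicator U p * H t p)"
  unfolding int_He_def
  using integral_energy_measure[OF _ integrableD(5)] by (simp add: mean_curvature_cancel)

lemma
  assumes "0 \<le> t1" "t1 \<le> t2" "t2 \<in> I"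
  shows integral_int_H: "(LBINT t:{t1..t2}. int_H A F \<nu> \<mu> U t) =
      (f_U A T F \<nu> \<mu> U t2 - f_U A T F \<nu> \<mu> U t1) / real CARD('n)"
    and integral_int_He: "(LBINT t:{t1..t2}. int_He A T F \<nu> \<mu> U t) =
      f_U A T F \<nu> \<mu> U t2 - f_U A T F \<nu> \<mu> U t1
        + (LINT p:U|\<mu> t1. \<sigma> t1 p) - (LINT p:U|\<mu> t2. \<sigma> t2 p)"
proof -
  have sub: "{t1..t2} \<subseteq> {0..t2}" using assms by auto
  have J: "{t1..t2} \<subseteq> I" using time_dom_Icc[OF assms(3)] sub by blast
  then have t1I: "t1 \<in> I" using assms by auto
  have cH: "continuous_on {t1..t2} (\<lambda>t. H t p)" and ce: "continuous_on {t1..t2} (\<lambda>t. e t p)" for p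
    using mean_curvature_continuous[OF assms(3)] energy_continuous[OF assms(3)] continuous_on_subset[OF _ sub]
    by blast+
  have dflux: "((\<lambda>s. flux CARD('n) (\<sigma> s p) / real CARD('n)) has_real_derivative H t p / e t p) (at t within {t1..t2})"
    and dgamma: "((\<lambda>s. gamma_fun CARD('n) (\<sigma> s p)) has_real_derivative H t p) (at t within {t1..t2})"
    if "t \<in> {t1..t2}" for t p
    using sub that
    by (auto intro!: DERIV_subset[OF flux_speed_derivative[OF assms(3)] sub]
        DERIV_subset[OF gamma_speed_derivative[OF assms(3)] sub])
  \<comment> \<open>The assumption on \<open>U\<close> bounds the space-time integrals with respect
    to the moving measures. At each time the inner integrals equal those against \<open>m\<close>,
    so finiteness is inherited.\<close>
  have fin: "(\<integral>\<^sup>+t\<in>{t1..t2}. (\<integral>\<^sup>+p. ennreal \<bar>indicator U p * (H t p / e t p)\<bar> \<partial>m) \<partial>lborel) < \<infinity>"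
    and fin': "(\<integral>\<^sup>+t\<in>{t1..t2}. (\<integral>\<^sup>+p. ennreal \<bar>indicator U p * H t p\<bar> \<partial>m) \<partial>lborel) < \<infinity>"
  proof -
    have "(\<integral>\<^sup>+t\<in>{t1..t2}. (\<integral>\<^sup>+p. ennreal \<bar>indicator U p * (H t p / e t p)\<bar> \<partial>m) \<partial>lborel) =
        (\<integral>\<^sup>+t\<in>{t1..t2}. (\<integral>\<^sup>+p\<in>U. ennreal \<bar>H t p\<bar> \<partial>\<mu> t) \<partial>lborel)"
      using J by (intro nn_integral_cong)
        (auto simp: nn_integral_energy_measure[OF _ integrableD(4)] subset_iff split: split_indicator)
    moreover have "(\<integral>\<^sup>+t\<in>{t1..t2}. (\<integral>\<^sup>+p. ennreal \<bar>indicator U p * H t p\<bar> \<partial>m) \<partial>lborel) =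
        (\<integral>\<^sup>+t\<in>{t1..t2}. (\<integral>\<^sup>+p\<in>U. ennreal \<bar>H t p * e t p\<bar> \<partial>\<mu> t) \<partial>lborel)"
      using J by (intro nn_integral_cong)
        (auto simp: nn_integral_energy_measure[OF _ integrableD(5)] mean_curvature_cancel subset_iff
          split: split_indicator)
    ultimately show "(\<integral>\<^sup>+t\<in>{t1..t2}. (\<integral>\<^sup>+p. ennreal \<bar>indicator U p * (H t p / e t p)\<bar> \<partial>m) \<partial>lborel) < \<infinity>"
      "(\<integral>\<^sup>+t\<in>{t1..t2}. (\<integral>\<^sup>+p. ennreal \<bar>indicator U p * H t p\<bar> \<partial>m) \<partial>lborel) < \<infinity>"
      using integrable t1I assms(3) by (auto simp: integrable_set_def)
  qed
  have "(LBINT t:{t1..t2}. int_H A F \<nu> \<mu> U t) = (LBINT t:{t1..t2}. (LINT p|m. indicator U p * (H t p / e t p)))"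
    by (rule set_lebesgue_integral_cong) (use J int_H_eq in auto)
  also have "\<dots> = (LINT p|m. indicator U p * (flux CARD('n) (\<sigma> t2 p) / real CARD('n))) -
      (LINT p|m. indicator U p * (flux CARD('n) (\<sigma> t1 p) / real CARD('n)))"
  proof (rule integral_FTC_swap[OF finite_energy_measure assms(2) _ _ _ _ _ fin])
    show "(\<lambda>p. indicator U p * (H t p / e t p)) \<in> borel_measurable m" if "t \<in> {t1..t2}" for t
      using measurable_energy_measure[OF _ integrableD(4)] that J by blast
    show "continuous_on {t1..t2} (\<lambda>t. indicator U p * (H t p / e t p))" for p
      using J energy_pos by (intro continuous_on_mult continuous_on_const continuous_on_divide cH ce)
        (auto simp: subset_iff less_imp_neq[symmetric])
    show "((\<lambda>t. indicator U p * (flux CARD('n) (\<sigma> t p) / real CARD('n))) has_real_derivative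
        indicator U p * (H t p / e t p)) (at t within {t1..t2})" if "t \<in> {t1..t2}" for t p
      by (rule DERIV_cmult[OF dflux[OF that]])
    have "integrable m (\<lambda>p. indicator U p * (flux CARD('n) (\<sigma> t p) / real CARD('n)))" if "t \<in> I" for t
      using integrable_divide[OF integrable_flux[OF that], of "real CARD('n)"] by simp
    then show "integrable m (\<lambda>p. indicator U p * (flux CARD('n) (\<sigma> t1 p) / real CARD('n)))"
      "integrable m (\<lambda>p. indicator U p * (flux CARD('n) (\<sigma> t2 p) / real CARD('n)))"
      using t1I assms(3) by blast+
  qed
  also have "\<dots> = (f_U A T F \<nu> \<mu> U t2 - f_U A T F \<nu> \<mu> U t1) / real CARD('n)"
    by (simp add: f_U_flux[OF t1I] f_U_flux[OF assms(3)] diff_divide_distrib)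
  finally show "(LBINT t:{t1..t2}. int_H A F \<nu> \<mu> U t) =
      (f_U A T F \<nu> \<mu> U t2 - f_U A T F \<nu> \<mu> U t1) / real CARD('n)" .
  have "(LBINT t:{t1..t2}. int_He A T F \<nu> \<mu> U t) = (LBINT t:{t1..t2}. (LINT p|m. indicator U p * H t p))"
    by (rule set_lebesgue_integral_cong) (use J int_He_eq in auto)
  also have "\<dots> = (LINT p|m. indicator U p * gamma_fun CARD('n) (\<sigma> t2 p)) -
      (LINT p|m. indicator U p * gamma_fun CARD('n) (\<sigma> t1 p))"
  proof (rule integral_FTC_swap[OF finite_energy_measure assms(2) _ _ _ _ _ fin'])
    show "(\<lambda>p. indicator U p * H t p) \<in> borel_measurable m" if "t \<in> {t1..t2}" for t
      using measurable_energy_measure[OF _ integrableD(5), of t] that J by (auto simp: mean_curvature_cancel)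
    show "continuous_on {t1..t2} (\<lambda>t. indicator U p * H t p)" for p
      by (intro continuous_on_mult continuous_on_const cH)
    show "((\<lambda>t. indicator U p * gamma_fun CARD('n) (\<sigma> t p)) has_real_derivative
        indicator U p * H t p) (at t within {t1..t2})" if "t \<in> {t1..t2}" for t p
      by (rule DERIV_cmult[OF dgamma[OF that]])
  qed (intro integrable_gamma t1I assms(3))+
  finally show "(LBINT t:{t1..t2}. int_He A T F \<nu> \<mu> U t) =
      f_U A T F \<nu> \<mu> U t2 - f_U A T F \<nu> \<mu> U t1
        + (LINT p:U|\<mu> t1. \<sigma> t1 p) - (LINT p:U|\<mu> t2. \<sigma> t2 p)"
    using f_U_minus_speed[OF t1I] f_U_minus_speed[OF assms(3)] by linarith
qed

lemma f_U_bound: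
  assumes "t \<in> I" "s \<in> I"
  shows "\<bar>f_U A T F \<nu> \<mu> U t\<bar> \<le> pi / sqrt (real CARD('n)) * E_U A T F \<mu> U s"
  unfolding f_U_flux[OF assms(1)]
  by (rule indicator_integral_bound[OF integrable_flux[OF assms(1)] flux_bound assms(2)]) simp

lemma f_U_minus_speed_bound:
  assumes "t \<in> I" "s \<in> I"
  shows "\<bar>f_U A T F \<nu> \<mu> U t - (LINT p:U|\<mu> t. \<sigma> t p)\<bar> \<le> pi / sqrt (real CARD('n)) * E_U A T F \<mu> U s"
  unfolding f_U_minus_speed[OF assms(1)]
  by (rule indicator_integral_bound[OF integrable_gamma[OF assms(1)] gamma_fun_bound assms(2)])

lemma E_U_nonneg: "s \<in> I \<Longrightarrow> 0 \<le> E_U A T F \<mu> U s"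
  by (simp add: E_U_eq integral_nonneg)

lemma f_U_diff_bound:
  assumes "t1 \<in> I" "t2 \<in> I" "s \<in> I"
  shows "1 / real CARD('n) * \<bar>f_U A T F \<nu> \<mu> U t2 - f_U A T F \<nu> \<mu> U t1\<bar>
          \<le> 2 * pi / (real CARD('n) * sqrt (real CARD('n))) * E_U A T F \<mu> U s"
proof -
  have "\<bar>f_U A T F \<nu> \<mu> U t2 - f_U A T F \<nu> \<mu> U t1\<bar> \<le> 2 * (pi / sqrt (real CARD('n)) * E_U A T F \<mu> U s)"
    using f_U_bound[OF assms(1,3)] f_U_bound[OF assms(2,3)] by linarith
  then have "1 / real CARD('n) * \<bar>f_U A T F \<nu> \<mu> U t2 - f_U A T F \<nu> \<mu> U t1\<bar> \<le>
      1 / real CARD('n) * (2 * (pi / sqrt (real CARD('n)) * E_U A T F \<mu> U s))"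
    by (rule mult_left_mono) simp
  then show ?thesis by (simp add: mult_ac)
qed

text \<open>With respect to \<open>m\<close> the speed integral cancels the summand \<sigma>/e of
  the flux and leaves \<gamma>, so two values differ by at most 2 pi / sqrt n times E_U. The larger
  constant arises when f_U and the speed integral are estimated separately, with |\<sigma>| / e
  \<le> 1 / sqrt n; it is reached here by enlarging pi to pi + 1.\<close>

lemma f_U_minus_speed_diff_bound:
  assumes "t1 \<in> I" "t2 \<in> I" "s \<in> I"
  shows "\<bar>f_U A T F \<nu> \<mu> U t2 - f_U A T F \<nu> \<mu> U t1
              + (LINT p:U|\<mu> t1. \<sigma> t1 p) - (LINT p:U|\<mu> t2. \<sigma> t2 p)\<bar>
          \<le> 2 * (pi + 1) / sqrt (real CARD('n)) * E_U A T F \<mu> U s"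
proof -
  have "\<bar>f_U A T F \<nu> \<mu> U t2 - f_U A T F \<nu> \<mu> U t1
              + (LINT p:U|\<mu> t1. \<sigma> t1 p) - (LINT p:U|\<mu> t2. \<sigma> t2 p)\<bar> \<le>
      2 * (pi / sqrt (real CARD('n)) * E_U A T F \<mu> U s)"
    using f_U_minus_speed_bound[OF assms(1,3)] f_U_minus_speed_bound[OF assms(2,3)] by linarith
  also have "\<dots> = 2 * pi / sqrt (real CARD('n)) * E_U A T F \<mu> U s" by simp
  also have "\<dots> \<le> 2 * (pi + 1) / sqrt (real CARD('n)) * E_U A T F \<mu> U s"
    by (intro mult_right_mono divide_right_mono E_U_nonneg assms(3)) auto
  finally show ?thesis .
qed

text \<open>The continuous function e H is bounded on the compact set [0, K] \<times> closure U.
  This yields the bounds for dominated convergence against \<open>m\<close>, where the integrands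
  are H / e and H.\<close>

lemma continuous_int_H_int_He:
  assumes T: "T = \<infinity>" and U: "compact (closure U)"
  shows "continuous_on {0..} (int_H A F \<nu> \<mu> U)" "continuous_on {0..} (int_He A T F \<nu> \<mu> U)"
proof -
  have I: "I = {0..}" by (auto simp: time_dom_def T)
  have bound: "\<exists>B. \<forall>t\<in>{0..}. \<forall>p. t \<le> K \<longrightarrow> \<bar>indicator U p * (H t p * e t p)\<bar> \<le> B" for K
  proof -
    have "compact ((\<lambda>(t, p). dt T (dt T F) t p \<bullet> \<nu> t p) ` ({0..K} \<times> closure U))"
      by (intro compact_continuous_image compact_Times compact_Icc U continuous_on_subset[OF continuous_acceleration])
         (auto simp: I)
    then obtain B where B: "\<forall>x\<in>(\<lambda>(t, p). dt T (dt T F) t p \<bullet> \<nu> t p) ` ({0..K} \<times> closure U). norm x \<le> B"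
      by (auto dest!: compact_imp_bounded simp only: bounded_iff)
    have "\<bar>indicator U p * (H t p * e t p)\<bar> \<le> \<bar>B\<bar>" if t: "0 \<le> t" "t \<le> K" for t p
    proof (cases "p \<in> U")
      case True
      then have "(t, p) \<in> {0..K} \<times> closure U" using t closure_subset[of U] by auto
      from B[rule_format, OF imageI[OF this]] have "\<bar>dt T (dt T F) t p \<bullet> \<nu> t p\<bar> \<le> B" by simp
      then show ?thesis using True acceleration_normal[of t p] t by (simp add: I mult.commute)
    qed simp
    then show ?thesis by auto
  qed
  have scale: "\<exists>B. \<forall>t\<in>{0..}. \<forall>p\<in>space m. t \<le> K \<longrightarrow> \<bar>indicator U p * X t p\<bar> \<le> B"
    if X: "\<And>t p. t \<in> I \<Longrightarrow> \<bar>X t p\<bar> \<le> k * \<bar>H t p * e t p\<bar>" and k: "k \<ge> 0" for X k K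
  proof -
    obtain B where B: "\<And>t p. 0 \<le> t \<Longrightarrow> t \<le> K \<Longrightarrow> \<bar>indicator U p * (H t p * e t p)\<bar> \<le> B"
      using bound[of K] by auto
    have "\<bar>indicator U p * X t p\<bar> \<le> k * \<bar>B\<bar>" if t: "0 \<le> t" "t \<le> K" for t p
    proof (cases "p \<in> U")
      case True
      have "\<bar>X t p\<bar> \<le> k * \<bar>H t p * e t p\<bar>" using X t by (simp add: I)
      also have "\<dots> \<le> k * \<bar>B\<bar>" using B[OF t, of p] True k by (intro mult_left_mono) auto
      finally show ?thesis using True by simp
    qed (use k in simp)
    then show ?thesis by auto
  qed
  \<comment> \<open>The reciprocal of the lower bound n / 2 of e: each division of e H by e costs
    one factor \<open>k\<close>.\<close>
  define k where "k = 2 / real CARD('n)"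
  have k: "k \<ge> 0" by (simp add: k_def)
  have inv: "1 / e t p \<le> k" if "t \<in> I" for t p
    using energy_ge[OF that, of p] energy_pos[OF that, of p]
    by (simp add: k_def field_simps)
  have bH: "\<bar>H t p\<bar> \<le> k * \<bar>H t p * e t p\<bar>" if "t \<in> I" for t p
  proof -
    have "\<bar>H t p\<bar> = 1 / e t p * \<bar>H t p * e t p\<bar>"
      using energy_pos[OF that, of p] by (simp add: abs_mult)
    also have "\<dots> \<le> k * \<bar>H t p * e t p\<bar>" by (intro mult_right_mono inv that) simp
    finally show ?thesis .
  qed
  have bHe: "\<bar>H t p / e t p\<bar> \<le> k * k * \<bar>H t p * e t p\<bar>" if "t \<in> I" for t p
  proof -
    have "\<bar>H t p / e t p\<bar> = 1 / e t p * \<bar>H t p\<bar>"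
      using energy_pos[OF that, of p] by (simp add: abs_divide)
    also have "\<dots> \<le> k * (k * \<bar>H t p * e t p\<bar>)" by (intro mult_mono inv bH that k) simp
    finally show ?thesis by simp
  qed
  \<comment> \<open>Continuity on compact initial intervals is enough, since [0, t + 1] is a
    neighbourhood of t in [0, \<infinity>).\<close>
  have glue: "continuous_on {0..} f" if f: "\<And>b. 0 \<le> b \<Longrightarrow> continuous_on {0..b} f" for f :: "real \<Rightarrow> real"
    unfolding continuous_on_eq_continuous_within
  proof
    fix t :: real assume t: "t \<in> {0..}"
    have "continuous (at t within {0..t + 1}) f"
      using f[of "t + 1"] t by (auto simp: continuous_on_eq_continuous_within)
    moreover have "at t within {0..t + 1} = at t within {0..}"
      by (rule at_within_nhd[of t "{..<t + 1}"]) (use t in auto)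
    ultimately show "continuous (at t within {0..}) f" by simp
  qed
  have cH: "continuous_on {0..} (\<lambda>t. H t p)" and ce: "continuous_on {0..} (\<lambda>t. e t p)" for p
    using glue mean_curvature_continuous energy_continuous by (simp_all add: I)
  have "continuous_on {0..} (\<lambda>t. LINT p|m. indicator U p * (H t p / e t p))"
  proof (rule continuous_on_integral_dominated[OF finite_energy_measure])
    show "(\<lambda>p. indicator U p * (H t p / e t p)) \<in> borel_measurable m" if "t \<in> {0..}" for t
      using measurable_energy_measure[OF _ integrableD(4), of t] that by (simp add: I)
    show "continuous_on {0..} (\<lambda>t. indicator U p * (H t p / e t p))" for p
      using energy_pos by (intro continuous_on_mult continuous_on_const continuous_on_divide cH ce)
        (auto simp: I less_imp_neq[symmetric])
  qed (use scale[OF bHe] k in auto)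
  then show "continuous_on {0..} (int_H A F \<nu> \<mu> U)"
    by (rule continuous_on_cong[THEN iffD1, rotated 2]) (auto simp: I int_H_eq)
  have "continuous_on {0..} (\<lambda>t. LINT p|m. indicator U p * H t p)"
  proof (rule continuous_on_integral_dominated[OF finite_energy_measure])
    show "(\<lambda>p. indicator U p * H t p) \<in> borel_measurable m" if "t \<in> {0..}" for t
      using measurable_energy_measure[OF _ integrableD(5), of t] that by (simp add: I mean_curvature_cancel)
    show "continuous_on {0..} (\<lambda>t. indicator U p * H t p)" for p
      by (intro continuous_on_mult continuous_on_const cH)
  qed (use scale[OF bH] k in auto)
  then show "continuous_on {0..} (int_He A T F \<nu> \<mu> U)"
    by (rule continuous_on_cong[THEN iffD1, rotated 2]) (auto simp: I int_He_eq)
qed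

end

text \<open>The bounds are stated with E_U at an arbitrary time \<open>s\<close>, in accordance with
  its independence of time. In the last part a small value is found because an integrand bounded
  away from 0 would keep its sign, which requires the space integral to be continuous in time. For
  \<open>U\<close> with compact closure this continuity is proved; for other \<open>U\<close> it
  appears as a premise.\<close>

theorem proposition7p1:
  fixes A :: "('m::{t2_space, second_countable_topology}, 'n::finite) chart set"
    and T :: ereal
    and F \<nu> :: "real \<Rightarrow> 'm \<Rightarrow> real ^ 'k::finite"
    and \<mu> :: "real \<Rightarrow> 'm measure"
    and U :: "'m set"
  assumes "smooth_atlas A" and "orientable A"
    and "CARD('k) = CARD('n) + 1"
    and "0 < T"
    and "hmcf_solution A T F \<nu>"
    and "\<And>t. t \<in> time_dom T \<Longrightarrow> is_volume_measure A (F t) (\<mu> t)"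
    and "integrable_set A T F \<nu> \<mu> U"
  shows
    "(\<forall>t1 t2 s. 0 \<le> t1 \<and> t1 \<le> t2 \<and> ereal t2 < T \<and> s \<in> time_dom T \<longrightarrow>
        \<bar>LBINT t:{t1..t2}. int_H A F \<nu> \<mu> U t\<bar>
          = 1 / real CARD('n) * \<bar>f_U A T F \<nu> \<mu> U t2 - f_U A T F \<nu> \<mu> U t1\<bar> \<and>
        1 / real CARD('n) * \<bar>f_U A T F \<nu> \<mu> U t2 - f_U A T F \<nu> \<mu> U t1\<bar>
          \<le> 2 * pi / (real CARD('n) * sqrt (real CARD('n))) * E_U A T F \<mu> U s \<and>
        \<bar>LBINT t:{t1..t2}. int_He A T F \<nu> \<mu> U t\<bar>
          = \<bar>f_U A T F \<nu> \<mu> U t2 - f_U A T F \<nu> \<mu> U t1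
              + (LINT p:U|\<mu> t1. normal_speed T F \<nu> t1 p) - (LINT p:U|\<mu> t2. normal_speed T F \<nu> t2 p)\<bar> \<and>
        \<bar>f_U A T F \<nu> \<mu> U t2 - f_U A T F \<nu> \<mu> U t1
              + (LINT p:U|\<mu> t1. normal_speed T F \<nu> t1 p) - (LINT p:U|\<mu> t2. normal_speed T F \<nu> t2 p)\<bar>
          \<le> 2 * (pi + 1) / sqrt (real CARD('n)) * E_U A T F \<mu> U s)
     \<and> (T = \<infinity> \<longrightarrow> (\<forall>\<epsilon>>0.
          (compact (closure U) \<or> continuous_on {0..} (int_H A F \<nu> \<mu> U) \<longrightarrow>
            (\<exists>\<tau>::nat \<Rightarrow> real. (\<forall>k. 0 \<le> \<tau> k) \<and> filterlim \<tau> at_top sequentially \<and>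
               (\<forall>k. \<bar>int_H A F \<nu> \<mu> U (\<tau> k)\<bar> < \<epsilon>))) \<and>
          (compact (closure U) \<or> continuous_on {0..} (int_He A T F \<nu> \<mu> U) \<longrightarrow>
            (\<exists>\<tau>::nat \<Rightarrow> real. (\<forall>k. 0 \<le> \<tau> k) \<and> filterlim \<tau> at_top sequentially \<and>
               (\<forall>k. \<bar>int_He A T F \<nu> \<mu> U (\<tau> k)\<bar> < \<epsilon>)))))"
proof -
  interpret hmcf_volume A T F \<nu> \<mu> U
    using assms by unfold_locales auto
  have main: "\<bar>LBINT t:{t1..t2}. int_H A F \<nu> \<mu> U t\<bar>
          = 1 / real CARD('n) * \<bar>f_U A T F \<nu> \<mu> U t2 - f_U A T F \<nu> \<mu> U t1\<bar> \<and>
        1 / real CARD('n) * \<bar>f_U A T F \<nu> \<mu> U t2 - f_U A T F \<nu> \<mu> U t1\<bar>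
          \<le> 2 * pi / (real CARD('n) * sqrt (real CARD('n))) * E_U A T F \<mu> U s \<and>
        \<bar>LBINT t:{t1..t2}. int_He A T F \<nu> \<mu> U t\<bar>
          = \<bar>f_U A T F \<nu> \<mu> U t2 - f_U A T F \<nu> \<mu> U t1
              + (LINT p:U|\<mu> t1. normal_speed T F \<nu> t1 p) - (LINT p:U|\<mu> t2. normal_speed T F \<nu> t2 p)\<bar> \<and>
        \<bar>f_U A T F \<nu> \<mu> U t2 - f_U A T F \<nu> \<mu> U t1
              + (LINT p:U|\<mu> t1. normal_speed T F \<nu> t1 p) - (LINT p:U|\<mu> t2. normal_speed T F \<nu> t2 p)\<bar>
          \<le> 2 * (pi + 1) / sqrt (real CARD('n)) * E_U A T F \<mu> U s"
    if t: "0 \<le> t1" "t1 \<le> t2" "ereal t2 < T" and s: "s \<in> I" for t1 t2 s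
  proof -
    have I: "t2 \<in> I" using t by (simp add: time_dom_def)
    then have I1: "t1 \<in> I" using time_dom_Icc[of t2 T] t by auto
    have "\<bar>LBINT t:{t1..t2}. int_H A F \<nu> \<mu> U t\<bar>
          = 1 / real CARD('n) * \<bar>f_U A T F \<nu> \<mu> U t2 - f_U A T F \<nu> \<mu> U t1\<bar>"
      by (simp add: integral_int_H[OF t(1,2) I] abs_divide)
    then show ?thesis
      using f_U_diff_bound[OF I1 I s] f_U_minus_speed_diff_bound[OF I1 I s]
      by (simp only: integral_int_He[OF t(1,2) I] simp_thms)
  qed
  have small: "(\<exists>\<tau>::nat \<Rightarrow> real. (\<forall>k. 0 \<le> \<tau> k) \<and> filterlim \<tau> at_top sequentially \<and>
               (\<forall>k. \<bar>int_H A F \<nu> \<mu> U (\<tau> k)\<bar> < \<epsilon>))"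
    if "T = \<infinity>" "\<epsilon> > 0" "continuous_on {0..} (int_H A F \<nu> \<mu> U)" for \<epsilon>
    by (rule small_values_of_bounded_primitive[OF that(3) _ that(2)])
       (use main[OF _ _ _ zero_I] that(1) in fastforce)
  have small': "(\<exists>\<tau>::nat \<Rightarrow> real. (\<forall>k. 0 \<le> \<tau> k) \<and> filterlim \<tau> at_top sequentially \<and>
               (\<forall>k. \<bar>int_He A T F \<nu> \<mu> U (\<tau> k)\<bar> < \<epsilon>))"
    if "T = \<infinity>" "\<epsilon> > 0" "continuous_on {0..} (int_He A T F \<nu> \<mu> U)" for \<epsilon>
    by (rule small_values_of_bounded_primitive[OF that(3) _ that(2)])
       (use main[OF _ _ _ zero_I] that(1) in fastforce)
  show ?thesis
    using main small small' continuous_int_H_int_He by (intro conjI allI impI) blast+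
qed

end
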